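(* Consider the Gaussian white noise model. Let $\mathcal F$ be a collection of functions $f:\mathbf R^d\to\mathbf R$ with $\sup_{g\in\mathcal F}\|g\|_2\le B_2$, $0<B_2<\infty$. For $\delta>0$ let $\mathcal F_\delta$ be a finite $\delta$-net of $\mathcal F$ in the $L_2$ norm, and set $$\varrho(Q,\mathcal F_\delta)=\max\Big\{\frac{\|Q(f-g)\|_2}{\|f-g\|_2}: f\in\mathcal F_\delta,\ g\in\mathcal F_{2\delta},\ f\ne g\Big\},\qquad G(\delta)=\int_0^\delta\varrho(Q,\mathcal F_u)\sqrt{\log_e(\#\mathcal F_u)}\,du,\ \ \delta\in(0,B_2].$$ Assume that 1. the integral defining $G$ converges; 2. $G(\delta)/\delta^2$ is decreasing on $(0,B_2]$; 3. $\varrho(Q,\mathcal F_\delta)=c\,\delta^{-a}$, where $0\le a<1$ and $c>0$; 4. $\lim_{\delta\to0}G(\delta)\delta^{a-1}=\infty$; 5. $\delta\mapsto\varrho(Q,\mathcal F_\delta)\sqrt{\log_e(\#\mathcal F_\delta)}$ is decreasing on $(0,B_2]$. Let $\epsilon>0$ and let $\hat f\in\mathcal F$ be an estimator with $\gamma_n(\hat f)\le\inf_{g\in\mathcal F}\gamma_n(g)+\epsilon$. Let $\psi_n$ be such that $\psi_n^2\ge C\,n^{-1/2}G(\psi_n)$, where $C$ is a positive constant, and assume $\lim_{n\to\infty}n\psi_n^{2(1+a)}=\infty$. Then there is a positive constant $C'$ such that for sufficiently large $n$, for all true $f\in\mathcal F$, $$E\|\hat f-f\|_2^2\le C'(\p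si_n^2+\epsilon).$$
   Context: Setting. $(\mathbf Y,\mathcal Y,\nu)$ is a Borel space with measure $\nu$; $A:L_2(\mathbf R^d)\to L_2(\mathbf Y,\nu)$ is a known linear operator with inverse $A^{-1}$, and $Q=(A^{-1})^*$ is the adjoint of the inverse, i.e. the linear operator with domain $L_2(\mathbf R^d)$ satisfying $\int_{\mathbf R^d}(A^{-1}h)\,g=\int_{\mathbf Y}h\,(Qg)\,d\nu$ for $h\in L_2(\mathbf Y,\nu)$, $g\in L_2(\mathbf R^d)$. Gaussian white noise model: one observes $dY_n=(Af)\,d\nu+n^{-1/2}dW$ on $\mathbf Y$, where $W$ is the Brownian process on $\mathbf Y$: for $h_1,h_2\in L_2(\mathbf Y,\nu)$ the vector $(\int h_1dW,\int h_2dW)$ is centered Gaussian with variances $\|h_1\|_{2,\nu}^2,\|h_2\|_{2,\nu}^2$ and covariance $\int h_1h_2\,d\nu$. Empirical risk: $\gamma_n(g)=-2\int_{\mathbf Y}(Qg)\,dY_n+\|g\|_2^2$. A $\delta$-net: for each $f\in\mathcal F$ there is $\phi\in\mathcal F_\delta$ with $\|f-\phi\|_2\le\delta$. $\#$ denotes cardinality. $\|\cdot\|_2$ of a function on $\mathbf Y$ is the $L_2(\nu)$ norm. The constant $C'$ does not depend on $n$, $f$ or $\epsilon$. $E$ is expectation under the true $f$.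
   Formalization: The noise process indexed by g in F, the integral of Qg against dW, is additionally assumed separable in Doob's sense for the L_2 distance; if W is fixed only by its Gaussian laws, changes on null sets depending on g can make the claim false for uncountable F. *)

theory Defs
  imports "HOL-Probability.Probability"
begin

text \<open>
  Elements of \<open>L\<^sub>2\<close> are represented by square-integrable functions; operators
  act on representatives and are only determined up to equality almost everywhere.
\<close>

definition L2_fun :: "'a measure \<Rightarrow> ('a \<Rightarrow> real) set" where
  "L2_fun M = {f \<in> borel_measurable M. integrable M (\<lambda>x. (f x)\<^sup>2)}"

definition L2_inner :: "'a measure \<Rightarrow> ('a \<Rightarrow> real) \<Rightarrow> ('a \<Rightarrow> real) \<Rightarrow> real" where
  "L2_inner M f g = (\<integral>x. f x * g x \<partial>M)"

definition L2_norm :: "'a measure \<Rightarrow> ('a \<Rightarrow> real) \<Rightarrow> real" where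
  "L2_norm M f = sqrt (\<integral>x. (f x)\<^sup>2 \<partial>M)"

definition L2_dense :: "'a measure \<Rightarrow> ('a \<Rightarrow> real) set \<Rightarrow> bool" where
  "L2_dense M D \<longleftrightarrow>
     (\<forall>f\<in>L2_fun M. \<forall>\<eta>>0. \<exists>g\<in>D. L2_norm M (\<lambda>x. f x - g x) < \<eta>)"

definition L2_linear ::
  "'a measure \<Rightarrow> 'b measure \<Rightarrow> (('a \<Rightarrow> real) \<Rightarrow> ('b \<Rightarrow> real)) \<Rightarrow> bool" where
  "L2_linear M N T \<longleftrightarrow>
     (\<forall>f\<in>L2_fun M. T f \<in> L2_fun N) \<and>
     (\<forall>f\<in>L2_fun M. \<forall>g\<in>L2_fun M.
        (AE x in M. f x = g x) \<longrightarrow> (AE y in N. T f y = T g y)) \<and>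
     (\<forall>f\<in>L2_fun M. \<forall>g\<in>L2_fun M. \<forall>a b.
        AE y in N. T (\<lambda>x. a * f x + b * g x) y = a * T f y + b * T g y)"

definition L2_range ::
  "'a measure \<Rightarrow> 'b measure \<Rightarrow> (('a \<Rightarrow> real) \<Rightarrow> ('b \<Rightarrow> real)) \<Rightarrow> ('b \<Rightarrow> real) set" where
  "L2_range M N T = {h \<in> L2_fun N. \<exists>f\<in>L2_fun M. AE y in N. h y = T f y}"

text \<open>
  The inverse of an operator lives on its range, which need not be all of \<open>L\<^sub>2\<close>.
  The condition below forces injectivity of \<open>T\<close> and makes \<open>S\<close> a two-sided inverse
  between \<open>L2_fun M\<close> and \<open>L2_range M N T\<close>.
\<close>

definition L2_inverse ::
  "'a measure \<Rightarrow> 'b measure \<Rightarrow> (('a \<Rightarrow> real) \<Rightarrow> ('b \<Rightarrow> real)) \<Rightarrow>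
   (('b \<Rightarrow> real) \<Rightarrow> ('a \<Rightarrow> real)) \<Rightarrow> bool" where
  "L2_inverse M N T S \<longleftrightarrow>
     (\<forall>f\<in>L2_fun M. \<forall>h\<in>L2_fun N. (AE y in N. h y = T f y) \<longrightarrow>
        S h \<in> L2_fun M \<and> (AE x in M. S h x = f x))"

text \<open>
  The adjoint of a possibly unbounded operator \<open>S\<close> with domain \<open>D\<close> in \<open>L2_fun N\<close>
  and values in \<open>L2_fun M\<close>. For dense \<open>D\<close> it is unique up to almost everywhere equality,
  and then linear on its domain. If \<open>D = L2_fun N\<close> and \<open>S\<close> is bounded, its domain is
  all of \<open>L2_fun M\<close>.
\<close>

definition L2_adjoint_dom ::
  "'a measure \<Rightarrow> 'b measure \<Rightarrow> ('b \<Rightarrow> real) set \<Rightarrow>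
   (('b \<Rightarrow> real) \<Rightarrow> ('a \<Rightarrow> real)) \<Rightarrow> ('a \<Rightarrow> real) set" where
  "L2_adjoint_dom M N D S =
     {g \<in> L2_fun M. \<exists>q\<in>L2_fun N. \<forall>h\<in>D. L2_inner M (S h) g = L2_inner N h q}"

definition L2_adjoint ::
  "'a measure \<Rightarrow> 'b measure \<Rightarrow> ('b \<Rightarrow> real) set \<Rightarrow>
   (('b \<Rightarrow> real) \<Rightarrow> ('a \<Rightarrow> real)) \<Rightarrow> (('a \<Rightarrow> real) \<Rightarrow> ('b \<Rightarrow> real)) \<Rightarrow> bool" where
  "L2_adjoint M N D S Q \<longleftrightarrow>
     (\<forall>g\<in>L2_adjoint_dom M N D S.
        Q g \<in> L2_fun N \<and> (\<forall>h\<in>D. L2_inner M (S h) g = L2_inner N h (Q g)))"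

text \<open>Variance \<open>0\<close> gives the point mass at \<open>0\<close>.\<close>

definition centered_gaussian :: "'w measure \<Rightarrow> ('w \<Rightarrow> real) \<Rightarrow> real \<Rightarrow> bool" where
  "centered_gaussian P X v \<longleftrightarrow>
     X \<in> borel_measurable P \<and>
     (if v = 0 then AE \<omega> in P. X \<omega> = 0
      else v > 0 \<and> distributed P lborel X (normal_density 0 (sqrt v)))"

text \<open>A vector is Gaussian if all linear combinations of its components are.\<close>

definition centered_gaussian_pair ::
  "'w measure \<Rightarrow> ('w \<Rightarrow> real) \<Rightarrow> ('w \<Rightarrow> real) \<Rightarrow> real \<Rightarrow> real \<Rightarrow> real \<Rightarrow> bool" where
  "centered_gaussian_pair P X Y vx vy cxy \<longleftrightarrow>
     (\<forall>s t. centered_gaussian P (\<lambda>\<omega>. s * X \<omega> + t * Y \<omega>)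
              (s\<^sup>2 * vx + 2 * s * t * cxy + t\<^sup>2 * vy))"

text \<open>\<open>W h\<close> stands for the stochastic integral of \<open>h\<close> with respect to the noise.\<close>

definition white_noise ::
  "'w measure \<Rightarrow> 'y measure \<Rightarrow> (('y \<Rightarrow> real) \<Rightarrow> 'w \<Rightarrow> real) \<Rightarrow> bool" where
  "white_noise P \<nu> W \<longleftrightarrow>
     (\<forall>h1\<in>L2_fun \<nu>. \<forall>h2\<in>L2_fun \<nu>.
        centered_gaussian_pair P (W h1) (W h2)
          ((L2_norm \<nu> h1)\<^sup>2) ((L2_norm \<nu> h2)\<^sup>2) (L2_inner \<nu> h1 h2))"

text \<open>
  Separability (in the sense of Doob) of a process indexed by \<open>F\<close> with the \<open>L\<^sub>2\<close> distance:
  outside a null set, the sample path is determined by its restriction to a countable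
  subset of \<open>F\<close>. The law of the noise only fixes \<open>W h\<close> up to null sets depending on
  \<open>h\<close>, so that without a choice of version pathwise statements such as minimisation over
  an uncountable class are meaningless.
\<close>

definition separable_process ::
  "'w measure \<Rightarrow> 'a measure \<Rightarrow> ('a \<Rightarrow> real) set \<Rightarrow> (('a \<Rightarrow> real) \<Rightarrow> 'w \<Rightarrow> real) \<Rightarrow> bool" where
  "separable_process P M F Z \<longleftrightarrow>
     (\<exists>S. countable S \<and> S \<subseteq> F \<and>
       (AE \<omega> in P. \<forall>g\<in>F. \<forall>\<eta>>0. \<exists>s\<in>S.
          L2_norm M (\<lambda>x. s x - g x) < \<eta> \<and> \<bar>Z s \<omega> - Z g \<omega>\<bar> < \<eta>))"

text \<open>The integral of \<open>h\<close> against the observation \<open>dY\<^sub>n = (A f) d\<nu> + n\<^sup>-\<^sup>1\<^sup>/\<^sup>2 dW\<close>.\<close>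

definition observed ::
  "'y measure \<Rightarrow> (('a \<Rightarrow> real) \<Rightarrow> ('y \<Rightarrow> real)) \<Rightarrow> (('y \<Rightarrow> real) \<Rightarrow> 'w \<Rightarrow> real) \<Rightarrow>
   nat \<Rightarrow> ('a \<Rightarrow> real) \<Rightarrow> ('y \<Rightarrow> real) \<Rightarrow> 'w \<Rightarrow> real" where
  "observed \<nu> A W n f h \<omega> = (\<integral>y. h y * A f y \<partial>\<nu>) + real n powr (-1/2) * W h \<omega>"

definition empirical_risk ::
  "'a measure \<Rightarrow> 'y measure \<Rightarrow> (('a \<Rightarrow> real) \<Rightarrow> ('y \<Rightarrow> real)) \<Rightarrow>
   (('a \<Rightarrow> real) \<Rightarrow> ('y \<Rightarrow> real)) \<Rightarrow> (('y \<Rightarrow> real) \<Rightarrow> 'w \<Rightarrow> real) \<Rightarrow>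
   nat \<Rightarrow> ('a \<Rightarrow> real) \<Rightarrow> ('a \<Rightarrow> real) \<Rightarrow> 'w \<Rightarrow> real" where
  "empirical_risk M \<nu> A Q W n f g \<omega> =
     - 2 * observed \<nu> A W n f (Q g) \<omega> + (L2_norm M g)\<^sup>2"

text \<open>The infimum is taken in the extended reals, where it is meaningful in any case.\<close>

definition near_minimizer ::
  "'a measure \<Rightarrow> 'y measure \<Rightarrow> (('a \<Rightarrow> real) \<Rightarrow> ('y \<Rightarrow> real)) \<Rightarrow>
   (('a \<Rightarrow> real) \<Rightarrow> ('y \<Rightarrow> real)) \<Rightarrow> (('y \<Rightarrow> real) \<Rightarrow> 'w \<Rightarrow> real) \<Rightarrow>
   nat \<Rightarrow> ('a \<Rightarrow> real) \<Rightarrow> ('a \<Rightarrow> real) set \<Rightarrow> real \<Rightarrow> ('a \<Rightarrow> real) \<Rightarrow> 'w \<Rightarrow> bool" where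
  "near_minimizer M \<nu> A Q W n f F \<epsilon> g \<omega> \<longleftrightarrow>
     ereal (empirical_risk M \<nu> A Q W n f g \<omega>) \<le>
       (INF u\<in>F. ereal (empirical_risk M \<nu> A Q W n f u \<omega>)) + ereal \<epsilon>"

definition L2_net :: "'a measure \<Rightarrow> ('a \<Rightarrow> real) set \<Rightarrow> real \<Rightarrow> ('a \<Rightarrow> real) set \<Rightarrow> bool" where
  "L2_net M F \<delta> N \<longleftrightarrow> (\<forall>f\<in>F. \<exists>\<phi>\<in>N. L2_norm M (\<lambda>x. f x - \<phi> x) \<le> \<delta>)"

text \<open>
  Functions are compared as elements of \<open>L\<^sub>2\<close>. The ratios are nonnegative, so the inserted
  \<open>0\<close> only serves to give a value to the maximum over an empty set of pairs.
\<close>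

definition operator_ratio ::
  "'a measure \<Rightarrow> 'y measure \<Rightarrow> (('a \<Rightarrow> real) \<Rightarrow> ('y \<Rightarrow> real)) \<Rightarrow>
   (real \<Rightarrow> ('a \<Rightarrow> real) set) \<Rightarrow> real \<Rightarrow> real" where
  "operator_ratio M \<nu> Q Net \<delta> =
     Max (insert 0
       {L2_norm \<nu> (Q (\<lambda>x. f x - g x)) / L2_norm M (\<lambda>x. f x - g x) | f g.
          f \<in> Net \<delta> \<and> g \<in> Net (2 * \<delta>) \<and> \<not> (AE x in M. f x = g x)})"

definition entropy_integrand ::
  "'a measure \<Rightarrow> 'y measure \<Rightarrow> (('a \<Rightarrow> real) \<Rightarrow> ('y \<Rightarrow> real)) \<Rightarrow>
   (real \<Rightarrow> ('a \<Rightarrow> real) set) \<Rightarrow> real \<Rightarrow> real" where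
  "entropy_integrand M \<nu> Q Net u =
     operator_ratio M \<nu> Q Net u * sqrt (ln (real (card (Net u))))"

definition entropy_integral ::
  "'a measure \<Rightarrow> 'y measure \<Rightarrow> (('a \<Rightarrow> real) \<Rightarrow> ('y \<Rightarrow> real)) \<Rightarrow>
   (real \<Rightarrow> ('a \<Rightarrow> real) set) \<Rightarrow> real \<Rightarrow> real" where
  "entropy_integral M \<nu> Q Net \<delta> =
     (LINT u:{0<..\<delta>}|lborel. entropy_integrand M \<nu> Q Net u)"

end

theory Submission
  imports Defs
begin

text \<open>
  Write \<open>D\<close> for the \<open>L\<^sub>2\<close> distance between \<open>fhat\<close> and \<open>f\<close>. Comparing the empirical risks of
  \<open>fhat\<close> and \<open>f\<close> gives \<open>D\<^sup>2 \<le> 2 * n powr (-1/2) * \<bar>W (Q fhat) - W (Q f)\<bar> + \<epsilon>\<close>. Chaining along the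
  nets at resolutions \<open>\<delta> / 2 ^ k\<close> shows that the fourth moment of the supremum of
  \<open>\<bar>W (Q f) - W (Q g)\<bar>\<close> over all pairs at distance at most \<open>8 * \<delta>\<close> is at most a constant times
  \<open>G \<delta> ^ 4\<close>; the links of the chains between points of the nets converge to points of the class
  because \<open>Q\<close>, being an adjoint, is closed. Since the entropy integrand decreases,
  \<open>G (2 ^ j * \<psi>) \<le> 2 ^ j * G \<psi>\<close>. On the shell where \<open>D\<close> is comparable to \<open>\<delta> = 2 ^ j * \<psi>\<close>, the
  basic inequality raised to the fourth power bounds \<open>D\<^sup>2\<close> by a variable of expectation of order
  \<open>(n powr (-1/2) * G \<delta>) ^ 4 / \<delta> ^ 6\<close>, hence of order \<open>\<psi>\<^sup>2 / 4 ^ j\<close>, and the sum over the shells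
  converges. Fourth moments make this sum converge; second moments would not.
\<close>

section \<open>Square integrable functions\<close>

lemma L2_funD:
  assumes "f \<in> L2_fun M"
  shows "f \<in> borel_measurable M" "integrable M (\<lambda>x. (f x)\<^sup>2)"
  using assms by (auto simp: L2_fun_def)

lemma L2_integrable_mult:
  assumes "f \<in> L2_fun M" "g \<in> L2_fun M"
  shows "integrable M (\<lambda>x. f x * g x)"
proof (rule Bochner_Integration.integrable_bound)
  show "integrable M (\<lambda>x. (f x)\<^sup>2 + (g x)\<^sup>2)"
    using assms by (intro Bochner_Integration.integrable_add L2_funD)
  show "(\<lambda>x. f x * g x) \<in> borel_measurable M"
    using assms[THEN L2_funD(1)] by measurable
  have "norm (u * v) \<le> norm (u\<^sup>2 + v\<^sup>2)" for u v :: real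
  proof -
    have "2 * (\<bar>u\<bar> * \<bar>v\<bar>) \<le> u\<^sup>2 + v\<^sup>2"
      using sum_squares_bound[of "\<bar>u\<bar>" "\<bar>v\<bar>"] by simp
    moreover have "0 \<le> \<bar>u\<bar> * \<bar>v\<bar>" by simp
    ultimately have "\<bar>u\<bar> * \<bar>v\<bar> \<le> u\<^sup>2 + v\<^sup>2" by linarith
    then show ?thesis by (simp add: abs_mult)
  qed
  then show "AE x in M. norm (f x * g x) \<le> norm ((f x)\<^sup>2 + (g x)\<^sup>2)" by auto
qed

lemma L2_fun_lincomb:
  assumes "f \<in> L2_fun M" "g \<in> L2_fun M"
  shows "(\<lambda>x. a * f x + b * g x) \<in> L2_fun M"
proof -
  have "integrable M (\<lambda>x. a\<^sup>2 * (f x)\<^sup>2 + 2 * a * b * (f x * g x) + b\<^sup>2 * (g x)\<^sup>2)"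
    using assms L2_integrable_mult[OF assms]
    by (intro Bochner_Integration.integrable_add integrable_mult_right) (auto dest: L2_funD)
  then have "integrable M (\<lambda>x. (a * f x + b * g x)\<^sup>2)"
    by (simp add: power2_sum power_mult_distrib mult_ac add_ac)
  then show ?thesis using assms[THEN L2_funD(1)] by (auto simp: L2_fun_def)
qed

lemma L2_fun_diff:
  assumes "f \<in> L2_fun M" "g \<in> L2_fun M"
  shows "(\<lambda>x. f x - g x) \<in> L2_fun M"
  using L2_fun_lincomb[OF assms, of 1 "-1"] by simp

lemma L2_norm_nonneg [simp]: "0 \<le> L2_norm M f"
  by (simp add: L2_norm_def)

lemma L2_norm_power2: "(L2_norm M f)\<^sup>2 = L2_inner M f f"
  by (simp add: L2_norm_def L2_inner_def power2_eq_square)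

lemma L2_norm_minus_commute: "L2_norm M (\<lambda>x. f x - g x) = L2_norm M (\<lambda>x. g x - f x)"
  by (simp add: L2_norm_def power2_commute)

lemma L2_inner_commute: "L2_inner M f g = L2_inner M g f"
  by (simp add: L2_inner_def mult.commute)

lemma L2_inner_diff_right:
  assumes "f \<in> L2_fun M" "g \<in> L2_fun M" "h \<in> L2_fun M"
  shows "L2_inner M f (\<lambda>x. g x - h x) = L2_inner M f g - L2_inner M f h"
  using assms by (simp add: L2_inner_def right_diff_distrib L2_integrable_mult)

lemma L2_inner_diff_left:
  assumes "f \<in> L2_fun M" "g \<in> L2_fun M" "h \<in> L2_fun M"
  shows "L2_inner M (\<lambda>x. g x - h x) f = L2_inner M g f - L2_inner M h f"
  using assms by (simp add: L2_inner_def left_diff_distrib L2_integrable_mult)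

lemma L2_norm_lincomb_power2:
  assumes "f \<in> L2_fun M" "g \<in> L2_fun M"
  shows "(L2_norm M (\<lambda>x. a * f x + b * g x))\<^sup>2
    = a\<^sup>2 * (L2_norm M f)\<^sup>2 + 2 * a * b * L2_inner M f g + b\<^sup>2 * (L2_norm M g)\<^sup>2"
proof -
  have "(L2_norm M (\<lambda>x. a * f x + b * g x))\<^sup>2
      = (\<integral>x. a\<^sup>2 * (f x * f x) + 2 * a * b * (f x * g x) + b\<^sup>2 * (g x * g x) \<partial>M)"
    unfolding L2_norm_power2 L2_inner_def
    by (intro arg_cong[where f = "integral\<^sup>L M"]) (auto simp: algebra_simps power2_eq_square)
  then show ?thesis
    using assms by (simp add: L2_norm_power2 L2_inner_def L2_integrable_mult)
qed

lemma L2_norm_diff_power2: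
  assumes "f \<in> L2_fun M" "g \<in> L2_fun M"
  shows "(L2_norm M (\<lambda>x. f x - g x))\<^sup>2
    = (L2_norm M f)\<^sup>2 - 2 * L2_inner M f g + (L2_norm M g)\<^sup>2"
  using L2_norm_lincomb_power2[OF assms, of 1 "-1"] by simp

lemma L2_norm_eq_0_iff:
  assumes "f \<in> L2_fun M"
  shows "L2_norm M f = 0 \<longleftrightarrow> (AE x in M. f x = 0)"
  using integral_nonneg_eq_0_iff_AE[of M "\<lambda>x. (f x)\<^sup>2"] L2_funD(2)[OF assms]
  by (simp add: L2_norm_def)

text \<open>Cauchy-Schwarz. The nonnegative quadratic form in \<open>a\<close> and \<open>b\<close>,
  evaluated at \<open>v\<close> and \<open>- u\<close>, gives the claim multiplied by
  \<open>2 * (u * v)\<close>; vanishing norms are split off because this factor is then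
  cancelled.\<close>

lemma L2_inner_le_norm:
  assumes f: "f \<in> L2_fun M" and g: "g \<in> L2_fun M"
  shows "L2_inner M f g \<le> L2_norm M f * L2_norm M g"
proof -
  define u v where "u = L2_norm M f" and "v = L2_norm M g"
  have *: "0 \<le> a\<^sup>2 * u\<^sup>2 + 2 * a * b * L2_inner M f g + b\<^sup>2 * v\<^sup>2" for a b
    unfolding u_def v_def L2_norm_lincomb_power2[OF f g, symmetric] by simp
  have uv: "u \<ge> 0" "v \<ge> 0" by (auto simp: u_def v_def)
  show ?thesis
  proof (cases "u = 0 \<or> v = 0")
    case True
    then have "AE x in M. f x * g x = 0"
      using L2_norm_eq_0_iff[OF f] L2_norm_eq_0_iff[OF g] by (auto simp: u_def v_def)
    then have "L2_inner M f g = 0"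
      unfolding L2_inner_def by (rule integral_eq_zero_AE)
    then show ?thesis by simp
  next
    case False
    then have "2 * (u * v) * L2_inner M f g \<le> 2 * (u * v) * (u * v)"
      using *[of v "- u"] by (simp add: power2_eq_square algebra_simps)
    moreover have "0 < u * v" using False uv by simp
    ultimately show ?thesis
      unfolding u_def[symmetric] v_def[symmetric] by (metis mult_le_cancel_left_pos mult_pos_pos zero_less_numeral)
  qed
qed

lemma L2_inner_abs_le_norm:
  assumes f: "f \<in> L2_fun M" and g: "g \<in> L2_fun M"
  shows "\<bar>L2_inner M f g\<bar> \<le> L2_norm M f * L2_norm M g"
proof -
  have "(\<lambda>x. - f x) \<in> L2_fun M" using L2_fun_lincomb[OF f f, of "-1" 0] by simp
  from L2_inner_le_norm[OF this g] L2_inner_le_norm[OF f g] show ?thesis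
    by (auto simp: L2_inner_def L2_norm_def abs_le_iff)
qed

lemma L2_norm_triangle:
  assumes f: "f \<in> L2_fun M" and g: "g \<in> L2_fun M" and h: "h \<in> L2_fun M"
  shows "L2_norm M (\<lambda>x. f x - h x) \<le> L2_norm M (\<lambda>x. f x - g x) + L2_norm M (\<lambda>x. g x - h x)"
proof (rule power2_le_imp_le)
  let ?u = "\<lambda>x. f x - g x" and ?v = "\<lambda>x. g x - h x"
  have uv: "?u \<in> L2_fun M" "?v \<in> L2_fun M" using assms by (auto intro: L2_fun_diff)
  have "(L2_norm M (\<lambda>x. f x - h x))\<^sup>2
      = (L2_norm M ?u)\<^sup>2 + 2 * L2_inner M ?u ?v + (L2_norm M ?v)\<^sup>2"
    using L2_norm_lincomb_power2[OF uv, of 1 1] by simp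
  also have "\<dots> \<le> (L2_norm M ?u + L2_norm M ?v)\<^sup>2"
    using L2_inner_le_norm[OF uv] by (simp add: power2_sum)
  finally show "(L2_norm M (\<lambda>x. f x - h x))\<^sup>2 \<le> \<dots>" .
qed simp

lemma L2_norm_diff_le:
  assumes f: "f \<in> L2_fun M" and g: "g \<in> L2_fun M"
  shows "L2_norm M (\<lambda>x. f x - g x) \<le> L2_norm M f + L2_norm M g"
  using L2_norm_triangle[OF f _ g, of "\<lambda>_. 0"]
  by (simp add: L2_fun_def L2_norm_def)

text \<open>A norm is recovered by duality with test functions from a dense set only.
  \<open>Q\<close> is given through inner products with the range of \<open>A\<close>, and this
  lemma turns information about those inner products into norm bounds.\<close>

lemma L2_norm_le_of_dense:
  assumes D: "L2_dense M D" "D \<subseteq> L2_fun M" and h: "h \<in> L2_fun M"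
    and le: "\<And>d. d \<in> D \<Longrightarrow> \<bar>L2_inner M d h\<bar> \<le> t * L2_norm M d"
    and t: "0 \<le> t"
  shows "L2_norm M h \<le> t"
proof (cases "L2_norm M h = 0")
  case True
  then show ?thesis using t by simp
next
  case False
  define u where "u = L2_norm M h"
  have "u > 0" using False L2_norm_nonneg[of M h] unfolding u_def by linarith
  have "u * u \<le> t * u + e" if "e > 0" for e
  proof -
    \<comment> \<open>Replacing \<open>h\<close> by \<open>g\<close> costs at most
      \<open>\<eta> * (t + u)\<close> in the estimate below, so this choice makes the total loss
      equal to \<open>e\<close>.\<close>
    define \<eta> where "\<eta> = e / (t + u)"
    have "\<eta> > 0" using that t \<open>u > 0\<close> by (simp add: \<eta>_def)
    then obtain g where g: "g \<in> D" "L2_norm M (\<lambda>x. h x - g x) < \<eta>"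
      using D h unfolding L2_dense_def by blast
    have gL: "g \<in> L2_fun M" using g D by auto
    have "u * u = L2_inner M h h" by (simp add: u_def L2_norm_power2[symmetric] power2_eq_square)
    also have "\<dots> = L2_inner M g h + L2_inner M (\<lambda>x. h x - g x) h"
      using L2_inner_diff_left[OF h h gL] by simp
    also have "\<dots> \<le> t * L2_norm M g + L2_norm M (\<lambda>x. h x - g x) * u"
      using le[OF g(1)] L2_inner_le_norm[OF L2_fun_diff[OF h gL] h] by (simp add: u_def)
    also have "\<dots> \<le> t * (u + \<eta>) + \<eta> * u"
    proof (intro add_mono mult_left_mono mult_right_mono)
      show "L2_norm M g \<le> u + \<eta>"
        using L2_norm_diff_le[OF h L2_fun_diff[OF h gL]] g(2) by (simp add: u_def)
    qed (use g t \<open>u > 0\<close> in auto)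
    also have "\<dots> = t * u + \<eta> * (t + u)" by (simp add: algebra_simps)
    also have "\<eta> * (t + u) = e" using t \<open>u > 0\<close> by (simp add: \<eta>_def)
    finally show ?thesis .
  qed
  then have "u * u \<le> t * u" by (rule field_le_epsilon)
  then show ?thesis using \<open>u > 0\<close> unfolding u_def[symmetric] by simp
qed

section \<open>The adjoint of the inverse operator\<close>

locale inverse_problem =
  fixes M :: "'a measure" and N :: "'y measure"
    and A :: "('a \<Rightarrow> real) \<Rightarrow> ('y \<Rightarrow> real)"
    and Ainv :: "('y \<Rightarrow> real) \<Rightarrow> ('a \<Rightarrow> real)"
    and Q :: "('a \<Rightarrow> real) \<Rightarrow> ('y \<Rightarrow> real)"
  assumes A_linear: "L2_linear M N A"
    and A_inverse: "L2_inverse M N A Ainv"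
    and range_dense: "L2_dense N (L2_range M N A)"
    and Q_adjoint: "L2_adjoint M N (L2_range M N A) Ainv Q"
begin

abbreviation "rangeA \<equiv> L2_range M N A"
abbreviation "domQ \<equiv> L2_adjoint_dom M N rangeA Ainv"

lemma ran_subset: "rangeA \<subseteq> L2_fun N"
  by (auto simp: L2_range_def)

lemma Ainv_ran: "d \<in> rangeA \<Longrightarrow> Ainv d \<in> L2_fun M"
  using A_inverse unfolding L2_range_def L2_inverse_def by blast

lemma dom_L2: "g \<in> domQ \<Longrightarrow> g \<in> L2_fun M"
  by (simp add: L2_adjoint_dom_def)

lemma Q_L2: "g \<in> domQ \<Longrightarrow> Q g \<in> L2_fun N"
  using Q_adjoint by (simp add: L2_adjoint_def)

lemma Q_inner: "g \<in> domQ \<Longrightarrow> d \<in> rangeA \<Longrightarrow> L2_inner N d (Q g) = L2_inner M (Ainv d) g"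
  using Q_adjoint by (simp add: L2_adjoint_def)

lemma Q_inner_diff:
  assumes "p \<in> domQ" "q \<in> domQ" "d \<in> rangeA"
  shows "L2_inner N d (\<lambda>y. Q p y - Q q y) = L2_inner M (Ainv d) (\<lambda>x. p x - q x)"
  using assms ran_subset
  by (subst (1 2) L2_inner_diff_right) (auto simp: Q_inner intro: Q_L2 dom_L2 Ainv_ran)

lemma dom_diff:
  assumes "p \<in> domQ" "q \<in> domQ"
  shows "(\<lambda>x. p x - q x) \<in> domQ"
proof -
  have "(\<lambda>x. p x - q x) \<in> L2_fun M" "(\<lambda>y. Q p y - Q q y) \<in> L2_fun N"
    using assms by (auto intro: L2_fun_diff Q_L2 dom_L2)
  then show ?thesis
    using Q_inner_diff[OF assms] unfolding L2_adjoint_dom_def by force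
qed

text \<open>Noise increments have variances given by \<open>Q p - Q q\<close>, whereas
  \<open>operator_ratio\<close> involves \<open>Q\<close> of a difference. Both functions have the
  same inner products with the dense range of \<open>A\<close>, so they differ by a function of norm
  zero.\<close>

lemma norm_Q_diff:
  assumes "p \<in> domQ" "q \<in> domQ"
  shows "L2_norm N (\<lambda>y. Q p y - Q q y) = L2_norm N (Q (\<lambda>x. p x - q x))"
proof -
  let ?u = "\<lambda>y. Q p y - Q q y" and ?v = "Q (\<lambda>x. p x - q x)"
  have L2: "?u \<in> L2_fun N" "?v \<in> L2_fun N"
    using assms by (auto intro: L2_fun_diff Q_L2 dom_diff)
  have "L2_norm N (\<lambda>y. ?u y - ?v y) \<le> 0"
  proof (rule L2_norm_le_of_dense[OF range_dense ran_subset])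
    fix d assume d: "d \<in> rangeA"
    have "L2_inner N d (\<lambda>y. ?u y - ?v y) = L2_inner N d ?u - L2_inner N d ?v"
      using d ran_subset L2 by (intro L2_inner_diff_right) auto
    also have "\<dots> = 0"
      using Q_inner_diff[OF assms d] Q_inner[OF dom_diff[OF assms] d] by simp
    finally show "\<bar>L2_inner N d (\<lambda>y. ?u y - ?v y)\<bar> \<le> 0 * L2_norm N d" by simp
  qed (use L2 in \<open>auto intro: L2_fun_diff\<close>)
  then have 0: "L2_norm N (\<lambda>y. ?u y - ?v y) = 0"
    using L2_norm_nonneg[of N "\<lambda>y. ?u y - ?v y"] by linarith
  have "L2_norm N ?u \<le> L2_norm N ?v"
    using L2_norm_triangle[OF L2 , of "\<lambda>_. 0"] 0 by (simp add: L2_fun_def)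
  moreover have "L2_norm N ?v \<le> L2_norm N ?u"
    using L2_norm_triangle[OF L2(2,1), of "\<lambda>_. 0"] 0 L2_norm_minus_commute[of N ?u ?v]
    by (simp add: L2_fun_def)
  ultimately show ?thesis by simp
qed

text \<open>Covers the pairs of almost everywhere equal functions, which the maximum in
  \<open>operator_ratio\<close> leaves out. Each inner product with some \<open>d\<close> in the
  range is moved by the adjoint relation to a function of norm zero.\<close>

lemma norm_Q_diff_eq_0:
  assumes "p \<in> domQ" "q \<in> domQ" "L2_norm M (\<lambda>x. p x - q x) = 0"
  shows "L2_norm N (\<lambda>y. Q p y - Q q y) = 0"
proof -
  have "L2_norm N (\<lambda>y. Q p y - Q q y) \<le> 0"
  proof (rule L2_norm_le_of_dense[OF range_dense ran_subset])
    fix d assume d: "d \<in> rangeA"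
    have "\<bar>L2_inner M (Ainv d) (\<lambda>x. p x - q x)\<bar> \<le> L2_norm M (Ainv d) * 0"
      unfolding assms(3)[symmetric] using assms d
      by (intro L2_inner_abs_le_norm L2_fun_diff dom_L2 Ainv_ran)
    then show "\<bar>L2_inner N d (\<lambda>y. Q p y - Q q y)\<bar> \<le> 0 * L2_norm N d"
      using Q_inner_diff[OF assms(1,2) d] by simp
  qed (use assms in \<open>auto intro: L2_fun_diff Q_L2\<close>)
  then show ?thesis using L2_norm_nonneg[of N "\<lambda>y. Q p y - Q q y"] by linarith
qed

text \<open>\<open>Q\<close> is an adjoint, hence closed.\<close>

lemma norm_Q_diff_limit_le:
  assumes dom: "p \<in> domQ" "f \<in> domQ" "\<And>m. \<phi> m \<in> domQ"
    and lim: "(\<lambda>m. L2_norm M (\<lambda>x. \<phi> m x - f x)) \<longlonglongrightarrow> 0"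
    and le: "\<forall>\<^sub>F m in sequentially. L2_norm N (\<lambda>y. Q p y - Q (\<phi> m) y) \<le> t"
    and t: "0 \<le> t"
  shows "L2_norm N (\<lambda>y. Q p y - Q f y) \<le> t"
proof (rule L2_norm_le_of_dense[OF range_dense ran_subset])
  fix d assume d: "d \<in> rangeA"
  have dL: "d \<in> L2_fun N" using d ran_subset by auto
  have "\<forall>\<^sub>F m in sequentially. \<bar>L2_inner N d (\<lambda>y. Q p y - Q f y)\<bar>
      \<le> t * L2_norm N d + L2_norm M (Ainv d) * L2_norm M (\<lambda>x. \<phi> m x - f x)"
    using le
  proof eventually_elim
    fix m assume m: "L2_norm N (\<lambda>y. Q p y - Q (\<phi> m) y) \<le> t"
    have "L2_inner N d (\<lambda>y. Q p y - Q f y)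
        = L2_inner N d (\<lambda>y. Q p y - Q (\<phi> m) y) + L2_inner N d (\<lambda>y. Q (\<phi> m) y - Q f y)"
      using dL dom by (subst (1 2 3) L2_inner_diff_right) (auto intro: Q_L2)
    \<comment> \<open>The difference \<open>Q (\<phi> m) - Q f\<close> is not known to be small in
      norm, but its inner product with the fixed \<open>d\<close> is: the adjoint relation moves it
      to \<open>\<phi> m - f\<close>, at the price of the fixed factor
      \<open>L2_norm M (Ainv d)\<close>.\<close>
    also have "\<bar>\<dots>\<bar> \<le> \<bar>L2_inner N d (\<lambda>y. Q p y - Q (\<phi> m) y)\<bar>
        + \<bar>L2_inner M (Ainv d) (\<lambda>x. \<phi> m x - f x)\<bar>"
      using Q_inner_diff[OF dom(3) dom(2) d] by simp
    also have "\<dots> \<le> L2_norm N d * L2_norm N (\<lambda>y. Q p y - Q (\<phi> m) y)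
        + L2_norm M (Ainv d) * L2_norm M (\<lambda>x. \<phi> m x - f x)"
      using dL d dom
      by (intro add_mono L2_inner_abs_le_norm) (auto intro: L2_fun_diff Q_L2 dom_L2 Ainv_ran)
    also have "L2_norm N d * L2_norm N (\<lambda>y. Q p y - Q (\<phi> m) y) \<le> t * L2_norm N d"
      using m by (subst mult.commute, intro mult_right_mono) auto
    finally show "\<bar>L2_inner N d (\<lambda>y. Q p y - Q f y)\<bar>
        \<le> t * L2_norm N d + L2_norm M (Ainv d) * L2_norm M (\<lambda>x. \<phi> m x - f x)" by simp
  qed
  moreover have "(\<lambda>m. t * L2_norm N d + L2_norm M (Ainv d) * L2_norm M (\<lambda>x. \<phi> m x - f x))
      \<longlonglongrightarrow> t * L2_norm N d + L2_norm M (Ainv d) * 0"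
    by (intro tendsto_intros lim)
  ultimately show "\<bar>L2_inner N d (\<lambda>y. Q p y - Q f y)\<bar> \<le> t * L2_norm N d"
    by (auto dest: tendsto_lowerbound)
qed (use assms in \<open>auto intro: L2_fun_diff Q_L2\<close>)

section \<open>The empirical risk and the basic inequality\<close>

text \<open>Since \<open>Ainv\<close> undoes \<open>A\<close>, testing the adjoint relation with
  \<open>A f\<close> shows that the noiseless part of the data recovers the inner product of
  \<open>f\<close> and \<open>g\<close>. This is why \<open>Q\<close> enters the empirical
  risk.\<close>

lemma inner_Q_A:
  assumes "g \<in> domQ" "f \<in> L2_fun M"
  shows "L2_inner N (Q g) (A f) = L2_inner M f g"
proof -
  have Af: "A f \<in> L2_fun N" using A_linear assms by (simp add: L2_linear_def)
  then have "A f \<in> rangeA" using assms by (auto simp: L2_range_def)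
  then have "L2_inner N (Q g) (A f) = L2_inner M (Ainv (A f)) g"
    using Q_inner[OF assms(1)] by (simp add: L2_inner_commute)
  moreover have "Ainv (A f) \<in> L2_fun M" and ae: "AE x in M. Ainv (A f) x = f x"
    using A_inverse assms Af unfolding L2_inverse_def by auto
  then have "L2_inner M (Ainv (A f)) g = L2_inner M f g"
    unfolding L2_inner_def using assms dom_L2[OF assms(1)]
    by (intro integral_cong_AE) (auto dest!: L2_funD(1))
  ultimately show ?thesis by simp
qed

text \<open>Completing the square: up to a term independent of \<open>g\<close>, the risk is the
  squared distance to \<open>f\<close> minus a multiple of the noise.\<close>

lemma empirical_risk_eq:
  assumes "f \<in> domQ" "g \<in> domQ"
  shows "empirical_risk M N A Q W n f g \<omega>
    = (L2_norm M (\<lambda>x. g x - f x))\<^sup>2 - (L2_norm M f)\<^sup>2 - 2 * real n powr (-1/2) * W (Q g) \<omega>"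
  unfolding empirical_risk_def observed_def
  using inner_Q_A[OF assms(2) dom_L2[OF assms(1)]]
    L2_norm_diff_power2[OF dom_L2[OF assms(2)] dom_L2[OF assms(1)]]
  by (simp add: L2_inner_def[of N] L2_inner_commute[of M g] algebra_simps)

text \<open>The infimum is at most the risk at \<open>f\<close>, which lies in \<open>F\<close>. The
  terms independent of the candidate cancel and only the noise increment between \<open>g\<close>
  and \<open>f\<close> remains.\<close>

lemma near_minimizer_norm_le:
  assumes F: "F \<subseteq> domQ" "f \<in> F" "g \<in> F" and min: "near_minimizer M N A Q W n f F \<epsilon> g \<omega>"
  shows "(L2_norm M (\<lambda>x. g x - f x))\<^sup>2
    \<le> 2 * real n powr (-1/2) * \<bar>W (Q g) \<omega> - W (Q f) \<omega>\<bar> + \<epsilon>"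
proof -
  have dom: "f \<in> domQ" "g \<in> domQ" using F by auto
  have "ereal (empirical_risk M N A Q W n f g \<omega>)
      \<le> (INF u\<in>F. ereal (empirical_risk M N A Q W n f u \<omega>)) + ereal \<epsilon>"
    using min by (simp add: near_minimizer_def)
  also have "\<dots> \<le> ereal (empirical_risk M N A Q W n f f \<omega>) + ereal \<epsilon>"
    using F by (intro add_mono INF_lower) auto
  finally have "empirical_risk M N A Q W n f g \<omega> \<le> empirical_risk M N A Q W n f f \<omega> + \<epsilon>"
    by simp
  then have "(L2_norm M (\<lambda>x. g x - f x))\<^sup>2
      \<le> 2 * real n powr (-1/2) * (W (Q g) \<omega> - W (Q f) \<omega>) + \<epsilon>"
    by (simp add: empirical_risk_eq dom L2_norm_def algebra_simps)
  also have "\<dots> \<le> 2 * real n powr (-1/2) * \<bar>W (Q g) \<omega> - W (Q f) \<omega>\<bar> + \<epsilon>"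
    by (intro add_right_mono mult_left_mono) auto
  finally show ?thesis .
qed

end

section \<open>Gaussian variables\<close>

text \<open>Multiplying the normal density of variance \<open>v\<close> by
  \<open>exp (x\<^sup>2 / (4 * v))\<close> yields \<open>sqrt 2\<close> times the density of
  variance \<open>2 * v\<close>, so the integral is \<open>sqrt 2\<close>. Passing from
  \<open>v\<close> to the upper bound \<open>s\<^sup>2\<close> only decreases the integrand.\<close>

lemma centered_gaussian_exp_square:
  assumes P: "prob_space P" and X: "centered_gaussian P X v" and v: "v \<le> s\<^sup>2" and s: "0 < s"
  shows "(\<integral>\<^sup>+\<omega>. ennreal (exp ((X \<omega>)\<^sup>2 / (4 * s\<^sup>2))) \<partial>P) \<le> 2"
proof -
  interpret prob_space P by fact
  show ?thesis
  proof (cases "v = 0")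
    case True
    then have "AE \<omega> in P. X \<omega> = 0" using X by (simp add: centered_gaussian_def)
    then have "(\<integral>\<^sup>+\<omega>. ennreal (exp ((X \<omega>)\<^sup>2 / (4 * s\<^sup>2))) \<partial>P) = (\<integral>\<^sup>+\<omega>. 1 \<partial>P)"
      by (intro nn_integral_cong_AE) auto
    then show ?thesis by (simp add: emeasure_space_1)
  next
    case False
    then have v0: "v > 0" and D: "distributed P lborel X (normal_density 0 (sqrt v))"
      using X by (auto simp: centered_gaussian_def)
    have "(\<integral>\<^sup>+\<omega>. ennreal (exp ((X \<omega>)\<^sup>2 / (4 * s\<^sup>2))) \<partial>P)
        \<le> (\<integral>\<^sup>+\<omega>. ennreal (exp ((X \<omega>)\<^sup>2 / (4 * v))) \<partial>P)"
      using v v0 s by (intro nn_integral_mono ennreal_leI) (auto intro!: divide_left_mono)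
    also have "\<dots> = (\<integral>\<^sup>+x. ennreal (normal_density 0 (sqrt v) x) * ennreal (exp (x\<^sup>2 / (4 * v))) \<partial>lborel)"
      by (rule distributed_nn_integral[OF D, symmetric]) simp
    also have "\<dots> = (\<integral>\<^sup>+x. ennreal (sqrt 2) * ennreal (normal_density 0 (sqrt (2 * v)) x) \<partial>lborel)"
    proof (intro nn_integral_cong)
      fix x :: real
      have "exp (- (x\<^sup>2 / (2 * v))) * exp (x\<^sup>2 / (4 * v)) = exp (- (x\<^sup>2 / (4 * v)))"
        unfolding exp_add[symmetric] using v0 by (intro arg_cong[where f = exp]) (simp add: field_simps)
      moreover have "sqrt (2 * pi * (2 * v)) = sqrt 2 * sqrt (2 * pi * v)"
        by (simp add: real_sqrt_mult)
      ultimately have "normal_density 0 (sqrt v) x * exp (x\<^sup>2 / (4 * v))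
          = sqrt 2 * normal_density 0 (sqrt (2 * v)) x"
        using v0 by (simp add: normal_density_def field_simps)
      then show "ennreal (normal_density 0 (sqrt v) x) * ennreal (exp (x\<^sup>2 / (4 * v)))
          = ennreal (sqrt 2) * ennreal (normal_density 0 (sqrt (2 * v)) x)"
        by (simp add: ennreal_mult[symmetric])
    qed
    also have "\<dots> = ennreal (sqrt 2) * (\<integral>\<^sup>+x. ennreal (normal_density 0 (sqrt (2 * v)) x) \<partial>lborel)"
      by (intro nn_integral_cmult) simp
    also have "(\<integral>\<^sup>+x. ennreal (normal_density 0 (sqrt (2 * v)) x) \<partial>lborel) = 1"
      using v0 by (subst nn_integral_eq_integral) auto
    also have "ennreal (sqrt 2) * 1 \<le> 2"
      using ennreal_leI[of "sqrt 2" 2] by (simp add: sqrt_le_D real_le_lsqrt)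
    finally show ?thesis .
  qed
qed

text \<open>Follows from the exponential moment by \<open>y \<le> exp y\<close> with
  \<open>y = (X \<omega>)\<^sup>2 / (4 * s\<^sup>2)\<close>, hence the constant
  \<open>8 = 4 * 2\<close>.\<close>

lemma centered_gaussian_second_moment:
  assumes P: "prob_space P" and X: "centered_gaussian P X v" and v: "v \<le> s\<^sup>2" and s: "0 < s"
  shows "(\<integral>\<^sup>+\<omega>. ennreal ((X \<omega>)\<^sup>2) \<partial>P) \<le> ennreal (8 * s\<^sup>2)"
proof -
  have X_meas: "X \<in> borel_measurable P" using X by (simp add: centered_gaussian_def)
  have "(X \<omega>)\<^sup>2 \<le> 4 * s\<^sup>2 * exp ((X \<omega>)\<^sup>2 / (4 * s\<^sup>2))" for \<omega>
  proof -
    have "(X \<omega>)\<^sup>2 / (4 * s\<^sup>2) \<le> exp ((X \<omega>)\<^sup>2 / (4 * s\<^sup>2))"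
      using exp_ge_add_one_self[of "(X \<omega>)\<^sup>2 / (4 * s\<^sup>2)"] by linarith
    then show ?thesis using s by (simp add: field_simps)
  qed
  then have "(\<integral>\<^sup>+\<omega>. ennreal ((X \<omega>)\<^sup>2) \<partial>P)
      \<le> (\<integral>\<^sup>+\<omega>. ennreal (4 * s\<^sup>2) * ennreal (exp ((X \<omega>)\<^sup>2 / (4 * s\<^sup>2))) \<partial>P)"
    by (intro nn_integral_mono) (auto simp: ennreal_mult[symmetric] intro: ennreal_leI)
  also have "\<dots> = ennreal (4 * s\<^sup>2) * (\<integral>\<^sup>+\<omega>. ennreal (exp ((X \<omega>)\<^sup>2 / (4 * s\<^sup>2))) \<partial>P)"
    using X_meas by (subst nn_integral_cmult) auto
  also have "\<dots> \<le> ennreal (4 * s\<^sup>2) * 2"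
    using centered_gaussian_exp_square[OF assms] by (rule mult_left_mono) simp
  also have "\<dots> = ennreal (8 * s\<^sup>2)"
    using ennreal_mult[of "4 * s\<^sup>2" 2] by (simp add: mult_ac)
  finally show ?thesis .
qed

section \<open>Increments of the noise and maxima of finitely many variables\<close>

lemma white_noise_diff:
  assumes "white_noise P N W" "h1 \<in> L2_fun N" "h2 \<in> L2_fun N"
  shows "centered_gaussian P (\<lambda>\<omega>. W h1 \<omega> - W h2 \<omega>) ((L2_norm N (\<lambda>y. h1 y - h2 y))\<^sup>2)"
proof -
  have "centered_gaussian_pair P (W h1) (W h2)
      ((L2_norm N h1)\<^sup>2) ((L2_norm N h2)\<^sup>2) (L2_inner N h1 h2)"
    using assms by (simp add: white_noise_def)
  then have "centered_gaussian P (\<lambda>\<omega>. 1 * W h1 \<omega> + (-1) * W h2 \<omega>)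
      (1\<^sup>2 * (L2_norm N h1)\<^sup>2 + 2 * 1 * (-1) * L2_inner N h1 h2 + (-1)\<^sup>2 * (L2_norm N h2)\<^sup>2)"
    unfolding centered_gaussian_pair_def by blast
  then show ?thesis by (simp add: L2_norm_diff_power2 assms)
qed

text \<open>The excess \<open>t = y - L\<close> satisfies \<open>t\<^sup>2 \<le> 2 * exp t\<close>
  by the quadratic Taylor bound. The factor \<open>exp (- L)\<close> on the right is what offsets
  the number of variables in a union bound.\<close>

lemma power2_le_exp_diff:
  fixes y L :: real
  assumes "0 \<le> y" "0 \<le> L"
  shows "y\<^sup>2 \<le> 2 * L\<^sup>2 + 4 * exp (y - L)"
proof (cases "y \<le> L")
  case True
  then have "y\<^sup>2 \<le> L\<^sup>2" using assms by (intro power_mono)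
  then show ?thesis using exp_ge_zero[of "y - L"] zero_le_power2[of L] by linarith
next
  case False
  define t where "t = y - L"
  have t: "0 \<le> t" using False by (simp add: t_def)
  have "t\<^sup>2 \<le> 2 * exp t"
    using exp_lower_Taylor_quadratic[OF t] t by simp
  moreover have "y\<^sup>2 \<le> 2 * L\<^sup>2 + 2 * t\<^sup>2"
    using sum_squares_bound[of L t] by (simp add: t_def power2_eq_square algebra_simps)
  ultimately show ?thesis by (simp add: t_def)
qed

text \<open>The union bound is taken in exponential moments, so that the number of variables only
  enters through its logarithm.\<close>

lemma fourth_power_maximal:
  fixes X :: "'i \<Rightarrow> 'w \<Rightarrow> real"
  assumes I: "finite I" "real (card I) \<le> exp L" "0 \<le> L" and s: "0 < s"
    and X: "\<And>i. i \<in> I \<Longrightarrow> X i \<in> borel_measurable P"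
    and E: "\<And>i. i \<in> I \<Longrightarrow> (\<integral>\<^sup>+\<omega>. ennreal (exp ((X i \<omega>)\<^sup>2 / (4 * s\<^sup>2))) \<partial>P) \<le> 2"
    and P: "prob_space P"
  obtains U where "U \<in> borel_measurable P" "\<And>\<omega>. 0 \<le> U \<omega>"
    "\<And>i \<omega>. i \<in> I \<Longrightarrow> X i \<omega> ^ 4 \<le> U \<omega>"
    "(\<integral>\<^sup>+\<omega>. ennreal (U \<omega>) \<partial>P) \<le> ennreal (16 * s ^ 4 * (2 * L\<^sup>2 + 8))"
proof
  interpret prob_space P by fact
  define e where "e = (\<lambda>i \<omega>. exp ((X i \<omega>)\<^sup>2 / (4 * s\<^sup>2)))"
  \<comment> \<open>The maximum is dominated by a sum. The weight \<open>exp (- L)\<close>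
    compensates for the at most \<open>exp L\<close> summands, each of expectation at most 2, which
    leaves \<open>4 * 2 = 8\<close> in the final bound.\<close>
  define U where "U = (\<lambda>\<omega>. 16 * s ^ 4 * (2 * L\<^sup>2 + 4 * exp (- L) * (\<Sum>i\<in>I. e i \<omega>)))"
  have e_meas: "e i \<in> borel_measurable P" if "i \<in> I" for i
    using X[OF that] unfolding e_def by measurable
  have e0: "0 \<le> e i \<omega>" for i \<omega> by (simp add: e_def)
  show "U \<in> borel_measurable P"
    unfolding U_def using e_meas by measurable
  show "0 \<le> U \<omega>" for \<omega>
    using s e0 unfolding U_def by (auto intro!: mult_nonneg_nonneg add_nonneg_nonneg sum_nonneg)
  show "X i \<omega> ^ 4 \<le> U \<omega>" if "i \<in> I" for i \<omega>
  proof -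
    let ?y = "(X i \<omega>)\<^sup>2 / (4 * s\<^sup>2)"
    have "X i \<omega> ^ 4 = 16 * s ^ 4 * ?y\<^sup>2"
      using s by (simp add: power_divide power_mult_distrib power2_eq_square[of "_ ^ 2"]
          power4_eq_xxxx power2_eq_square)
    also have "\<dots> \<le> 16 * s ^ 4 * (2 * L\<^sup>2 + 4 * exp (?y - L))"
      using power2_le_exp_diff[of ?y L] I by (intro mult_left_mono) auto
    also have "exp (?y - L) = exp (- L) * e i \<omega>"
      by (simp add: e_def exp_diff exp_minus field_simps)
    also have "\<dots> \<le> exp (- L) * (\<Sum>i\<in>I. e i \<omega>)"
      using member_le_sum[OF that, of "\<lambda>i. e i \<omega>"] e0 I by (intro mult_left_mono) auto
    finally show ?thesis using s by (simp add: U_def mult_left_mono algebra_simps)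
  qed
  have "(\<integral>\<^sup>+\<omega>. ennreal (U \<omega>) \<partial>P) = (\<integral>\<^sup>+\<omega>. ennreal (16 * s ^ 4 * (2 * L\<^sup>2))
      + ennreal (64 * s ^ 4 * exp (- L)) * (\<Sum>i\<in>I. ennreal (e i \<omega>)) \<partial>P)"
    using s e0 unfolding U_def
    by (intro nn_integral_cong) (simp add: ennreal_mult[symmetric] sum_nonneg
      ennreal_plus[symmetric] algebra_simps del: ennreal_plus)
  also have "\<dots> = ennreal (16 * s ^ 4 * (2 * L\<^sup>2))
      + ennreal (64 * s ^ 4 * exp (- L)) * (\<Sum>i\<in>I. \<integral>\<^sup>+\<omega>. ennreal (e i \<omega>) \<partial>P)"
    using e_meas
    by (subst nn_integral_add, simp, measurable)
       (simp add: nn_integral_cmult nn_integral_sum emeasure_space_1)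
  also have "\<dots> \<le> ennreal (16 * s ^ 4 * (2 * L\<^sup>2)) + ennreal (64 * s ^ 4 * exp (- L)) * (\<Sum>i\<in>I. 2)"
    using E unfolding e_def by (intro add_left_mono mult_left_mono sum_mono) auto
  also have "(\<Sum>i\<in>I. 2 :: ennreal) = ennreal (2 * real (card I))"
    by (simp add: ennreal_mult ennreal_of_nat_eq_real_of_nat mult.commute)
  also have "ennreal (16 * s ^ 4 * (2 * L\<^sup>2)) + ennreal (64 * s ^ 4 * exp (- L)) * \<dots>
      = ennreal (16 * s ^ 4 * (2 * L\<^sup>2) + 64 * s ^ 4 * exp (- L) * (2 * real (card I)))"
    using s by (simp add: ennreal_mult[symmetric] ennreal_plus[symmetric] del: ennreal_plus)
  also have "\<dots> \<le> ennreal (16 * s ^ 4 * (2 * L\<^sup>2) + 64 * s ^ 4 * exp (- L) * (2 * exp L))"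
    using I s by (intro ennreal_leI add_left_mono mult_left_mono) auto
  also have "\<dots> = ennreal (16 * s ^ 4 * (2 * L\<^sup>2 + 8))"
    by (intro arg_cong[where f = ennreal]) (simp add: exp_minus field_simps)
  finally show "(\<integral>\<^sup>+\<omega>. ennreal (U \<omega>) \<partial>P) \<le> ennreal (16 * s ^ 4 * (2 * L\<^sup>2 + 8))" .
qed

text \<open>The sum of all the squares has finite expectation, so it is finite almost surely and its
  terms tend to zero.\<close>

lemma AE_tendsto_0_of_second_moments:
  fixes X :: "nat \<Rightarrow> 'w \<Rightarrow> real"
  assumes X: "\<And>k. X k \<in> borel_measurable P"
    and E: "\<And>k. (\<integral>\<^sup>+\<omega>. ennreal ((X k \<omega>)\<^sup>2) \<partial>P) \<le> ennreal (v k)"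
    and v: "\<And>k. 0 \<le> v k" "summable v"
  shows "AE \<omega> in P. (\<lambda>k. X k \<omega>) \<longlonglongrightarrow> 0"
proof -
  have "(\<integral>\<^sup>+\<omega>. (\<Sum>k. ennreal ((X k \<omega>)\<^sup>2)) \<partial>P) = (\<Sum>k. \<integral>\<^sup>+\<omega>. ennreal ((X k \<omega>)\<^sup>2) \<partial>P)"
    using X by (intro nn_integral_suminf) measurable
  also have "\<dots> \<le> (\<Sum>k. ennreal (v k))"
    by (intro suminf_le E) auto
  also have "\<dots> = ennreal (\<Sum>k. v k)"
    using v by (rule suminf_ennreal2)
  finally have "(\<integral>\<^sup>+\<omega>. (\<Sum>k. ennreal ((X k \<omega>)\<^sup>2)) \<partial>P) \<noteq> \<infinity>"
    by (metis ennreal_neq_top infinity_ennreal_def neq_top_trans)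
  then have "AE \<omega> in P. (\<Sum>k. ennreal ((X k \<omega>)\<^sup>2)) \<noteq> \<infinity>"
    using X by (intro nn_integral_PInf_AE) measurable
  then show ?thesis
  proof eventually_elim
    case (elim \<omega>)
    then have "summable (\<lambda>k. (X k \<omega>)\<^sup>2)"
      by (intro summable_suminf_not_top) (auto simp: infinity_ennreal_def)
    then have "(\<lambda>k. (X k \<omega>)\<^sup>2) \<longlonglongrightarrow> 0" by (rule summable_LIMSEQ_zero)
    then have "(\<lambda>k. sqrt ((X k \<omega>)\<^sup>2)) \<longlonglongrightarrow> sqrt 0" by (rule tendsto_real_sqrt)
    then show ?case by (simp add: tendsto_rabs_zero_iff)
  qed
qed

section \<open>Entropy\<close>

text \<open>Walk from \<open>x (Suc n)\<close> down to \<open>x 1\<close>, across to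
  \<open>y 0\<close>, and up to \<open>y (Suc n)\<close>. The link is skewed because
  \<open>operator_ratio\<close> compares a net with the one of twice its resolution.
  \<open>T 0\<close> is used by the link and by the first step of \<open>y\<close>, every other
  \<open>T k\<close> by one step of each chain, whence the factor 2.\<close>

lemma abs_diff_le_links:
  fixes x y T :: "nat \<Rightarrow> real"
  assumes x: "\<And>k. \<bar>x (Suc k) - x k\<bar> \<le> T k" and y: "\<And>k. \<bar>y (Suc k) - y k\<bar> \<le> T k"
    and link: "\<bar>x 1 - y 0\<bar> \<le> T 0"
  shows "\<bar>x (Suc n) - y (Suc n)\<bar> \<le> 2 * (\<Sum>k\<le>n. T k)"
proof (induction n)
  case 0
  show ?case using link y[of 0] by simp
next
  case (Suc n)
  then show ?case using x[of "Suc n"] y[of "Suc n"] by simp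
qed

text \<open>Hoelder's inequality with exponents 4 and 4/3, obtained from two applications of
  Cauchy-Schwarz. In the chaining the weights \<open>b\<close> are the levels of the links, so that
  the expectation of each summand on the right is of order \<open>b k\<close>.\<close>

lemma sum_power4_le:
  fixes T b :: "'i \<Rightarrow> real"
  assumes b: "\<And>k. k \<in> I \<Longrightarrow> 0 < b k"
  shows "(\<Sum>k\<in>I. T k) ^ 4 \<le> (\<Sum>k\<in>I. b k) ^ 3 * (\<Sum>k\<in>I. T k ^ 4 / b k ^ 3)"
proof -
  have b0: "0 \<le> (\<Sum>k\<in>I. b k)" using b by (intro sum_nonneg) (auto intro: less_imp_le)
  have CS: "(\<Sum>k\<in>I. T k * s k)\<^sup>2 \<le> (\<Sum>k\<in>I. b k) * (\<Sum>k\<in>I. (T k * s k)\<^sup>2 / b k)" for s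
  proof -
    have "(\<Sum>k\<in>I. T k * s k) = (\<Sum>k\<in>I. sqrt (b k) * (T k * s k / sqrt (b k)))"
      using b by (intro sum.cong) (auto dest: b less_imp_neq)
    also have "\<dots>\<^sup>2 \<le> (\<Sum>k\<in>I. (sqrt (b k))\<^sup>2) * (\<Sum>k\<in>I. (T k * s k / sqrt (b k))\<^sup>2)"
      by (rule Cauchy_Schwarz_ineq_sum)
    also have "\<dots> = (\<Sum>k\<in>I. b k) * (\<Sum>k\<in>I. (T k * s k)\<^sup>2 / b k)"
      using b by (simp add: power_divide less_imp_le)
    finally show ?thesis .
  qed
  have "(\<Sum>k\<in>I. T k) ^ 4 = ((\<Sum>k\<in>I. T k)\<^sup>2)\<^sup>2" by (simp flip: power_mult)
  also have "\<dots> \<le> ((\<Sum>k\<in>I. b k) * (\<Sum>k\<in>I. (T k)\<^sup>2 / b k))\<^sup>2"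
    using CS[of "\<lambda>_. 1"] by (intro power_mono) auto
  also have "\<dots> = (\<Sum>k\<in>I. b k)\<^sup>2 * (\<Sum>k\<in>I. T k * (T k / b k))\<^sup>2"
    by (simp add: power_mult_distrib power2_eq_square)
  also have "\<dots> \<le> (\<Sum>k\<in>I. b k)\<^sup>2 * ((\<Sum>k\<in>I. b k) * (\<Sum>k\<in>I. (T k * (T k / b k))\<^sup>2 / b k))"
    by (intro mult_left_mono CS) auto
  also have "\<dots> = (\<Sum>k\<in>I. b k) ^ 3 * (\<Sum>k\<in>I. T k ^ 4 / b k ^ 3)"
    by (simp add: power_mult_distrib power_divide power2_eq_square power3_eq_cube
        power4_eq_xxxx mult_ac)
  finally show ?thesis .
qed

locale entropy_problem = inverse_problem M N A Ainv Q
  for M :: "'a measure" and N :: "'y measure"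
    and A :: "('a \<Rightarrow> real) \<Rightarrow> ('y \<Rightarrow> real)"
    and Ainv :: "('y \<Rightarrow> real) \<Rightarrow> ('a \<Rightarrow> real)"
    and Q :: "('a \<Rightarrow> real) \<Rightarrow> ('y \<Rightarrow> real)" +
  fixes F :: "('a \<Rightarrow> real) set" and Net :: "real \<Rightarrow> ('a \<Rightarrow> real) set"
    and G :: "real \<Rightarrow> real" and B2 a c :: real
  assumes F_dom: "F \<subseteq> domQ"
    and B2_pos: "0 < B2"
    and Net_dom: "\<forall>\<delta>>0. Net \<delta> \<subseteq> domQ"
    and Net_finite: "\<forall>\<delta>>0. finite (Net \<delta>)"
    and Net_net: "\<forall>\<delta>>0. L2_net M F \<delta> (Net \<delta>)"
    and G_def: "G = entropy_integral M N Q Net"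
    and G_converges:
      "\<forall>\<delta>\<in>{0<..B2}. set_integrable lborel {0<..\<delta>} (entropy_integrand M N Q Net)"
    and a_range: "0 \<le> a" "a < 1"
    and c_pos: "c > 0"
    and ratio_eq: "\<forall>\<delta>\<in>{0<..B2}. operator_ratio M N Q Net \<delta> = c * \<delta> powr (- a)"
    and G_limit: "filterlim (\<lambda>\<delta>. G \<delta> * \<delta> powr (a - 1)) at_top (at_right 0)"
    and integrand_decreasing: "antimono_on {0<..B2} (entropy_integrand M N Q Net)"
begin

section \<open>Entropy of the nets and size of the operator on them\<close>

abbreviation "h \<equiv> entropy_integrand M N Q Net"

definition sqrt_entropy :: "real \<Rightarrow> real" where
  "sqrt_entropy u = sqrt (ln (real (card (Net u))))"

text \<open>An empty net is covered by the convention \<open>ln 0 = 0\<close>.\<close>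

lemma ln_card_nonneg: "0 \<le> ln (real (card (Net u)))"
  by (cases "card (Net u)") auto

lemma sqrt_entropy_nonneg [simp]: "0 \<le> sqrt_entropy u"
  by (simp add: sqrt_entropy_def ln_card_nonneg)

lemma card_Net_le: "real (card (Net u)) \<le> exp ((sqrt_entropy u)\<^sup>2)"
  by (cases "card (Net u)") (auto simp: sqrt_entropy_def)

lemma integrand_eq: "u \<in> {0<..B2} \<Longrightarrow> h u = c * u powr (- a) * sqrt_entropy u"
  using ratio_eq by (simp add: entropy_integrand_def sqrt_entropy_def)

lemma integrand_nonneg: "u \<in> {0<..B2} \<Longrightarrow> 0 \<le> h u"
  using c_pos by (simp add: integrand_eq)

lemma integrand_antimono: "u \<in> {0<..B2} \<Longrightarrow> v \<in> {0<..B2} \<Longrightarrow> u \<le> v \<Longrightarrow> h v \<le> h u"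
  using integrand_decreasing by (auto simp: monotone_on_def)

text \<open>A substitute for monotonicity of the cardinalities. Doubling \<open>u\<close> multiplies
  the operator factor by \<open>2 powr (- a)\<close>, which is at least 1/2; as the integrand
  decreases, the entropy factor can at most double.\<close>

lemma sqrt_entropy_double:
  assumes u: "0 < u" "2 * u \<le> B2"
  shows "sqrt_entropy (2 * u) \<le> 2 * sqrt_entropy u"
proof -
  have "c * (2 * u) powr (- a) * sqrt_entropy (2 * u) \<le> c * u powr (- a) * sqrt_entropy u"
    using integrand_antimono[of u "2 * u"] u by (simp add: integrand_eq)
  then have "c * u powr (- a) * (2 powr (- a) * sqrt_entropy (2 * u)) \<le> c * u powr (- a) * sqrt_entropy u"
    using u by (simp add: powr_mult mult_ac)
  then have "2 powr (- a) * sqrt_entropy (2 * u) \<le> sqrt_entropy u"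
    using c_pos u by (simp add: mult_le_cancel_left)
  moreover have "1 / 2 \<le> (2 :: real) powr (- a)"
    using powr_mono[of "- 1" "- a" 2] a_range by (simp add: powr_minus_divide)
  then have "1 / 2 * sqrt_entropy (2 * u) \<le> 2 powr (- a) * sqrt_entropy (2 * u)"
    by (intro mult_right_mono) auto
  ultimately show ?thesis by linarith
qed

text \<open>Between nets at resolutions \<open>u\<close> and \<open>2 * u\<close> the possibly
  unbounded \<open>Q\<close> behaves like an operator of norm \<open>c * u powr (- a)\<close>. A
  distance of order \<open>u\<close> turns this into the power \<open>1 - a\<close>, which is
  summable along halvings of \<open>u\<close>.\<close>

lemma norm_Q_Net_diff_le:
  assumes u: "u \<in> {0<..B2}" and p: "p \<in> Net u" and q: "q \<in> Net (2 * u)"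
    and le: "L2_norm M (\<lambda>x. p x - q x) \<le> K * u"
  shows "L2_norm N (\<lambda>y. Q p y - Q q y) \<le> K * c * u powr (1 - a)"
proof -
  have "0 < u" "0 < 2 * u" using u by auto
  then have dom: "p \<in> domQ" "q \<in> domQ" using p q Net_dom by blast+
  have K: "0 \<le> K * u" using le L2_norm_nonneg order_trans by blast
  have powr: "K * c * u powr (1 - a) = c * u powr (- a) * (K * u)"
    using u by (simp add: powr_diff powr_minus_divide)
  show ?thesis
  proof (cases "L2_norm M (\<lambda>x. p x - q x) = 0")
    case True
    then show ?thesis
      using norm_Q_diff_eq_0[OF dom] K c_pos unfolding powr by simp
  next
    case False
    let ?S = "{L2_norm N (Q (\<lambda>x. f x - g x)) / L2_norm M (\<lambda>x. f x - g x) | f g.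
          f \<in> Net u \<and> g \<in> Net (2 * u) \<and> \<not> (AE x in M. f x = g x)}"
    have "?S \<subseteq> (\<lambda>(f, g). L2_norm N (Q (\<lambda>x. f x - g x)) / L2_norm M (\<lambda>x. f x - g x))
        ` (Net u \<times> Net (2 * u))" by auto
    moreover have "finite (Net u \<times> Net (2 * u))" using Net_finite u by auto
    ultimately have fin: "finite ?S" by (meson finite_imageI finite_subset)
    have "\<not> (AE x in M. p x = q x)"
      using False L2_norm_eq_0_iff[OF L2_fun_diff[OF dom[THEN dom_L2]]] by simp
    then have "L2_norm N (Q (\<lambda>x. p x - q x)) / L2_norm M (\<lambda>x. p x - q x) \<in> ?S"
      using p q by blast
    then have "L2_norm N (Q (\<lambda>x. p x - q x)) / L2_norm M (\<lambda>x. p x - q x)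
        \<le> operator_ratio M N Q Net u"
      unfolding operator_ratio_def using fin by (intro Max_ge) auto
    also have "\<dots> = c * u powr (- a)" using ratio_eq u by simp
    finally have "L2_norm N (Q (\<lambda>x. p x - q x)) \<le> c * u powr (- a) * L2_norm M (\<lambda>x. p x - q x)"
      using False L2_norm_nonneg[of M "\<lambda>x. p x - q x"] by (simp add: divide_le_eq split: if_splits)
    also have "\<dots> \<le> c * u powr (- a) * (K * u)"
      using le c_pos by (intro mult_left_mono) auto
    finally show ?thesis unfolding powr norm_Q_diff[OF dom] .
  qed
qed

section \<open>Approximation by points of the nets\<close>

definition near :: "real \<Rightarrow> ('a \<Rightarrow> real) \<Rightarrow> ('a \<Rightarrow> real)" where
  "near u f = (SOME p. p \<in> Net u \<and> L2_norm M (\<lambda>x. f x - p x) \<le> u)"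

lemma near:
  assumes "0 < u" "f \<in> F"
  shows "near u f \<in> Net u" "L2_norm M (\<lambda>x. f x - near u f x) \<le> u" "near u f \<in> domQ"
proof -
  have "\<exists>p. p \<in> Net u \<and> L2_norm M (\<lambda>x. f x - p x) \<le> u"
    using Net_net assms unfolding L2_net_def by blast
  from someI_ex[OF this]
  show "near u f \<in> Net u" "L2_norm M (\<lambda>x. f x - near u f x) \<le> u"
    by (auto simp: near_def)
  then show "near u f \<in> domQ" using Net_dom assms by blast
qed

lemma F_L2: "f \<in> F \<Longrightarrow> f \<in> L2_fun M"
  using F_dom dom_L2 by blast

lemma norm_near_diff_le:
  assumes "0 < u" "f \<in> F" "0 < v" "g \<in> F"
  shows "L2_norm M (\<lambda>x. near u f x - near v g x) \<le> u + L2_norm M (\<lambda>x. f x - g x) + v"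
proof -
  have L2: "f \<in> L2_fun M" "g \<in> L2_fun M" "near u f \<in> L2_fun M" "near v g \<in> L2_fun M"
    using assms near F_L2 dom_L2 by auto
  show ?thesis
    using L2_norm_triangle[OF L2(3,1,4)] L2_norm_triangle[OF L2(1,2,4)]
      near(2)[OF assms(1,2)] near(2)[OF assms(3,4)]
      L2_norm_minus_commute[of M "near u f" f] by linarith
qed

text \<open>The decay rate of \<open>u powr (1 - a)\<close> under halving of \<open>u\<close>.\<close>

definition r :: real where "r = 2 powr (a - 1)"

lemma r_range: "0 < r" "r < 1"
  using a_range powr_less_mono[of "a - 1" 0 2] by (auto simp: r_def)

lemma halving_powr: "0 < \<delta> \<Longrightarrow> (\<delta> / 2 ^ k) powr (1 - a) = \<delta> powr (1 - a) * r ^ k"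
proof -
  assume "0 < \<delta>"
  have "((2::real) ^ k) powr (1 - a) = (2 powr (1 - a)) ^ k"
    by (simp add: powr_realpow[symmetric] powr_powr mult.commute)
  moreover have "r = 1 / 2 powr (1 - a)"
    by (simp add: r_def powr_minus_divide[symmetric])
  ultimately show ?thesis using \<open>0 < \<delta>\<close>
    by (simp add: powr_divide power_one_over)
qed

lemma halving_sum_le: "0 < \<delta> \<Longrightarrow> (\<Sum>k\<in>{i..<j}. (\<delta> / 2 ^ k) powr (1 - a)) \<le> \<delta> powr (1 - a) * (r ^ i / (1 - r))"
proof -
  assume "0 < \<delta>"
  have "(\<Sum>k\<in>{i..<j}. r ^ k) \<le> r ^ i / (1 - r)"
  proof (cases "i \<le> j")
    case True
    then have "(\<Sum>k\<in>{i..<j}. r ^ k) * (1 - r) = r ^ i - r ^ j"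
    proof (induction j rule: dec_induct)
      case (step n)
      have "(\<Sum>k\<in>{i..<Suc n}. r ^ k) * (1 - r) = (\<Sum>k\<in>{i..<n}. r ^ k) * (1 - r) + r ^ n * (1 - r)"
        using step.hyps by (simp add: distrib_right)
      also have "\<dots> = r ^ i - r ^ Suc n" unfolding step.IH by (simp add: algebra_simps)
      finally show ?case .
    qed simp
    then show ?thesis using r_range by (simp add: pos_le_divide_eq)
  qed (use r_range in auto)
  then have "\<delta> powr (1 - a) * (\<Sum>k\<in>{i..<j}. r ^ k) \<le> \<delta> powr (1 - a) * (r ^ i / (1 - r))"
    by (intro mult_left_mono) auto
  then show ?thesis using \<open>0 < \<delta>\<close>
    by (simp only: halving_powr sum_distrib_left)
qed

section \<open>The entropy integral \<open>G\<close>\<close>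

lemma integrand_interval:
  assumes "0 \<le> s" "s \<le> t" "t \<le> B2"
  shows "set_integrable lborel {s<..t} h"
proof (cases "0 < t")
  case True
  then have "set_integrable lborel {0<..t} h" using G_converges assms by simp
  then show ?thesis by (rule set_integrable_subset) (use assms in auto)
qed (use assms in \<open>simp add: set_integrable_def\<close>)

lemma G_diff:
  assumes "0 \<le> s" "s \<le> t" "t \<le> B2"
  shows "G t = G s + (LINT u:{s<..t}|lborel. h u)"
proof -
  have "{0<..t} = {0<..s} \<union> {s<..t}" using assms by auto
  then show ?thesis
    unfolding G_def entropy_integral_def
    using set_integral_Un[of "{0<..s}" "{s<..t}" lborel h] integrand_interval[of 0 s]
      integrand_interval[of s t] assms by auto
qed

lemma G_0: "G 0 = 0"
  by (simp add: G_def entropy_integral_def set_lebesgue_integral_def)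

lemma interval_const_integrable:
  "s \<le> t \<Longrightarrow> set_integrable lborel {s<..t :: real} (\<lambda>_. k :: real)"
  unfolding set_integrable_def real_scaleR_def
  by (intro integrable_mult_left integrable_real_indicator) (auto simp: emeasure_lborel_Ioc)

lemma interval_const_integral: "s \<le> t \<Longrightarrow> (LINT u:{s<..t :: real}|lborel. k) = (t - s) * (k :: real)"
  by (simp add: set_lebesgue_integral_def)

lemma integrand_integral_le:
  assumes "0 \<le> s" "s \<le> t" "t \<le> B2" "\<And>u. s < u \<Longrightarrow> u \<le> t \<Longrightarrow> h u \<le> k"
  shows "(LINT u:{s<..t}|lborel. h u) \<le> (t - s) * k"
  unfolding interval_const_integral[OF assms(2), symmetric]
  using assms by (intro set_integral_mono integrand_interval interval_const_integrable) auto

lemma integrand_integral_ge: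
  assumes "0 \<le> s" "s \<le> t" "t \<le> B2" "\<And>u. s < u \<Longrightarrow> u \<le> t \<Longrightarrow> k \<le> h u"
  shows "(t - s) * k \<le> (LINT u:{s<..t}|lborel. h u)"
  unfolding interval_const_integral[OF assms(2), symmetric]
  using assms by (intro set_integral_mono integrand_interval interval_const_integrable) auto

lemma G_mono:
  assumes "0 \<le> s" "s \<le> t" "t \<le> B2"
  shows "G s \<le> G t"
  using G_diff[OF assms] integrand_integral_ge[OF assms, of 0] integrand_nonneg assms by auto

lemma G_nonneg: "0 \<le> t \<Longrightarrow> t \<le> B2 \<Longrightarrow> 0 \<le> G t"
  using G_mono[of 0 t] by (simp add: G_0)

text \<open>As the integrand decreases, its integral over \<open>{t<..2 * t}\<close> is at most
  \<open>t * h t\<close>, while over \<open>{0<..t}\<close> it is at least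
  \<open>t * h t\<close>.\<close>

lemma G_double:
  assumes "0 < t" "2 * t \<le> B2"
  shows "G (2 * t) \<le> 2 * G t"
proof -
  have "G (2 * t) \<le> G t + (2 * t - t) * h t"
    using G_diff[of t "2 * t"] integrand_integral_le[of t "2 * t" "h t"] assms
      integrand_antimono[of t] by auto
  moreover have "(t - 0) * h t \<le> G t"
    using G_diff[of 0 t] G_0 integrand_integral_ge[of 0 t "h t"] assms
      integrand_antimono[of _ t] by auto
  ultimately show ?thesis by simp
qed

lemma G_double_power:
  assumes "0 < t" "2 ^ j * t \<le> B2"
  shows "G (2 ^ j * t) \<le> 2 ^ j * G t"
  using assms(2)
proof (induction j)
  case (Suc j)
  then have le: "2 * (2 ^ j * t) \<le> B2" by simp
  moreover have "0 \<le> 2 ^ j * t" using assms by simp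
  ultimately have "2 ^ j * t \<le> B2" by linarith
  then have "G (2 * (2 ^ j * t)) \<le> 2 * (2 ^ j * G t)"
    using Suc.IH G_double[OF _ le] assms(1) by simp
  then show ?case by (simp add: mult.assoc)
qed simp

text \<open>Up to the factor 2 this is a lower Riemann sum on dyadic intervals: the integral from
  \<open>u / 2\<close> to \<open>u\<close> is at least \<open>u / 2 * h u\<close>, and the
  differences of \<open>G\<close> telescope.\<close>

lemma integrand_sum_le:
  assumes "0 < \<delta>" "\<delta> \<le> B2"
  shows "(\<Sum>k<n. \<delta> / 2 ^ k * h (\<delta> / 2 ^ k)) \<le> 2 * G \<delta>"
proof -
  have "\<delta> / 2 ^ n \<le> \<delta>" using assms by (simp add: divide_le_eq)
  then have pos: "0 \<le> G (\<delta> / 2 ^ n)" using assms by (intro G_nonneg) auto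
  have "(\<Sum>k<n. \<delta> / 2 ^ k * h (\<delta> / 2 ^ k)) \<le> 2 * (G \<delta> - G (\<delta> / 2 ^ n))"
  proof (induction n)
    case (Suc n)
    define u where "u = \<delta> / 2 ^ n"
    have "u \<le> \<delta>" using assms by (simp add: u_def divide_le_eq)
    then have u: "0 < u" "u \<le> B2" using assms by (auto simp: u_def)
    have "(u - u / 2) * h u \<le> G u - G (u / 2)"
      using G_diff[of "u / 2" u] integrand_integral_ge[of "u / 2" u "h u"]
        integrand_antimono[of _ u] u by auto
    then have "u * h u \<le> 2 * (G u - G (u / 2))" by (simp add: field_simps)
    then show ?case using Suc by (simp add: u_def mult.commute)
  qed simp
  also have "\<dots> \<le> 2 * G \<delta>" using pos by simp
  finally show ?thesis .
qed

text \<open>Allows the entropy-free terms of the chaining to be absorbed into \<open>G\<close>. Near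
  zero the bound comes from \<open>G_limit\<close>; away from zero, \<open>G\<close> is at least
  \<open>G s\<close> by monotonicity and the power is at most its value at
  \<open>B2\<close>.\<close>

lemma powr_le_G:
  obtains K where "0 < K" "\<And>\<delta>. 0 < \<delta> \<Longrightarrow> \<delta> \<le> B2 \<Longrightarrow> \<delta> powr (1 - a) \<le> K * G \<delta>"
proof -
  have "\<forall>\<^sub>F \<delta> in at_right 0. 1 \<le> G \<delta> * \<delta> powr (a - 1)"
    using G_limit by (simp add: filterlim_at_top)
  then obtain b where b: "0 < b" "\<And>\<delta>. 0 < \<delta> \<Longrightarrow> \<delta> < b \<Longrightarrow> 1 \<le> G \<delta> * \<delta> powr (a - 1)"
    by (auto simp: eventually_at_right_field)
  have small: "\<delta> powr (1 - a) \<le> G \<delta>" if "0 < \<delta>" "\<delta> < b" for \<delta>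
  proof -
    have "\<delta> powr (1 - a) * 1 \<le> \<delta> powr (1 - a) * (G \<delta> * \<delta> powr (a - 1))"
      using b(2)[OF that] by (intro mult_left_mono) auto
    also have "\<dots> = G \<delta> * (\<delta> powr (1 - a) * \<delta> powr (a - 1))" by simp
    also have "\<delta> powr (1 - a) * \<delta> powr (a - 1) = 1"
      using that by (simp add: powr_add[symmetric])
    finally show ?thesis by simp
  qed
  \<comment> \<open>Halving puts \<open>s\<close> strictly below \<open>b\<close>, so that
    \<open>small\<close> applies at \<open>s\<close> itself.\<close>
  define s where "s = min b B2 / 2"
  have s: "0 < s" "s < b" "s \<le> B2" using b B2_pos by (auto simp: s_def)
  define K where "K = max 1 (B2 powr (1 - a) / s powr (1 - a))"
  have "\<delta> powr (1 - a) \<le> K * G \<delta>" if \<delta>: "0 < \<delta>" "\<delta> \<le> B2" for \<delta>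
  proof (cases "\<delta> < s")
    case True
    then have "\<delta> powr (1 - a) \<le> G \<delta>" using small \<delta> s by simp
    also have "\<dots> \<le> K * G \<delta>"
      using mult_right_mono[of 1 K "G \<delta>"] G_nonneg[of \<delta>] \<delta> by (simp add: K_def)
    finally show ?thesis .
  next
    case False
    have "\<delta> powr (1 - a) \<le> B2 powr (1 - a)" using \<delta> a_range by (intro powr_mono2) auto
    also have "\<dots> = B2 powr (1 - a) / s powr (1 - a) * s powr (1 - a)" using s by simp
    also have "\<dots> \<le> K * G s"
      using small[of s] s by (intro mult_mono) (auto simp: K_def)
    also have "\<dots> \<le> K * G \<delta>"
      using False \<delta> s by (intro mult_left_mono G_mono) (auto simp: K_def)
    finally show ?thesis .
  qed
  moreover have "0 < K" by (simp add: K_def)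
  ultimately show ?thesis using that by blast
qed

end

section \<open>Chaining\<close>

locale white_noise_problem = entropy_problem M N A Ainv Q F Net G B2 a c
  for M :: "'a measure" and N :: "'y measure"
    and A :: "('a \<Rightarrow> real) \<Rightarrow> ('y \<Rightarrow> real)"
    and Ainv :: "('y \<Rightarrow> real) \<Rightarrow> ('a \<Rightarrow> real)"
    and Q :: "('a \<Rightarrow> real) \<Rightarrow> ('y \<Rightarrow> real)"
    and F :: "('a \<Rightarrow> real) set" and Net :: "real \<Rightarrow> ('a \<Rightarrow> real) set"
    and G :: "real \<Rightarrow> real" and B2 a c :: real +
  fixes P :: "'w measure" and W :: "('y \<Rightarrow> real) \<Rightarrow> 'w \<Rightarrow> real"
  assumes P_prob: "prob_space P"
    and W_noise: "white_noise P N W"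
    and separable: "separable_process P M F (\<lambda>g. W (Q g))"
begin

section \<open>Increments of the noise between two consecutive nets\<close>

abbreviation "Z g \<equiv> W (Q g)"

lemma Z_diff_gaussian:
  assumes "p \<in> domQ" "q \<in> domQ"
  shows "centered_gaussian P (\<lambda>\<omega>. Z p \<omega> - Z q \<omega>) ((L2_norm N (\<lambda>y. Q p y - Q q y))\<^sup>2)"
  using assms by (intro white_noise_diff[OF W_noise] Q_L2)

lemma Z_diff_measurable:
  "p \<in> domQ \<Longrightarrow> q \<in> domQ \<Longrightarrow> (\<lambda>\<omega>. Z p \<omega> - Z q \<omega>) \<in> borel_measurable P"
  using Z_diff_gaussian by (simp add: centered_gaussian_def)

text \<open>Up to a constant, the size of the largest increment of \<open>Z\<close> over the relevant pairs in the
  nets at resolutions \<open>u\<close> and \<open>2 * u\<close>. The factor \<open>12 = 1 + 9 + 2\<close> comes from the link that joins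
  the chains of two points of the class at distance at most \<open>9 * u\<close>.\<close>

definition level :: "real \<Rightarrow> real" where
  "level u = 12 * c * u powr (1 - a) * (1 + sqrt_entropy u)"

lemma level_pos: "0 < u \<Longrightarrow> 0 < level u"
  using c_pos by (simp add: level_def add_pos_nonneg)

text \<open>Separates an entropy-free part, geometric along halvings of \<open>u\<close>, from the
  part that forms Riemann sums of \<open>G\<close>.\<close>

lemma level_eq: "u \<in> {0<..B2} \<Longrightarrow> level u = 12 * c * u powr (1 - a) + 12 * (u * h u)"
  by (simp add: level_def integrand_eq powr_diff powr_minus_divide field_simps)

text \<open>A single measurable \<open>U\<close> dominates all pairs at every
  \<open>\<omega>\<close>, so that it can stand for the maximum of their fourth powers.\<close>

definition level_bound :: "real \<Rightarrow> ('w \<Rightarrow> real) \<Rightarrow> bool" where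
  "level_bound u U \<longleftrightarrow> U \<in> borel_measurable P \<and> (\<forall>\<omega>. 0 \<le> U \<omega>) \<and>
    (\<forall>p\<in>Net u. \<forall>q\<in>Net (2 * u). L2_norm M (\<lambda>x. p x - q x) \<le> 12 * u \<longrightarrow>
      (\<forall>\<omega>. (Z p \<omega> - Z q \<omega>) ^ 4 \<le> U \<omega>)) \<and>
    (\<integral>\<^sup>+\<omega>. ennreal (U \<omega>) \<partial>P) \<le> ennreal (800 * level u ^ 4)"

lemma ex_level_bound:
  assumes u: "0 < u" "2 * u \<le> B2"
  shows "\<exists>U. level_bound u U"
proof -
  define I where "I = {(p, q). p \<in> Net u \<and> q \<in> Net (2 * u) \<and> L2_norm M (\<lambda>x. p x - q x) \<le> 12 * u}"
  define X where "X = (\<lambda>(p, q) \<omega>. Z p \<omega> - Z q \<omega>)"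
  define \<sigma> where "\<sigma> = 12 * c * u powr (1 - a)"
  \<comment> \<open>The logarithm of the number of pairs is at most
    \<open>s\<^sup>2 + (2 * s)\<^sup>2\<close> with \<open>s = sqrt_entropy u\<close>, by
    \<open>sqrt_entropy_double\<close>.\<close>
  define L where "L = 5 * (sqrt_entropy u)\<^sup>2"
  have \<sigma>: "0 < \<sigma>" using c_pos u by (simp add: \<sigma>_def)
  have L0: "0 \<le> L" by (simp add: L_def)
  have fin: "finite (Net u \<times> Net (2 * u))" using Net_finite u by auto
  have sub: "I \<subseteq> Net u \<times> Net (2 * u)" by (auto simp: I_def)
  have "real (card I) \<le> real (card (Net u \<times> Net (2 * u)))"
    using card_mono[OF fin sub] by simp
  also have "\<dots> = real (card (Net u)) * real (card (Net (2 * u)))"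
    by (simp add: card_cartesian_product)
  also have "\<dots> \<le> exp ((sqrt_entropy u)\<^sup>2) * exp ((sqrt_entropy (2 * u))\<^sup>2)"
    by (intro mult_mono card_Net_le) auto
  also have "\<dots> = exp ((sqrt_entropy u)\<^sup>2 + (sqrt_entropy (2 * u))\<^sup>2)"
    by (simp add: exp_add)
  also have "\<dots> \<le> exp L"
    using power_mono[OF sqrt_entropy_double[OF u], of 2]
    by (simp add: L_def power_mult_distrib)
  finally have card: "real (card I) \<le> exp L" .
  have "0 < u" "0 < 2 * u" using u by auto
  then have domI: "p \<in> domQ" "q \<in> domQ" if "(p, q) \<in> I" for p q
    using that Net_dom unfolding I_def by blast+
  have X_meas: "X i \<in> borel_measurable P" if "i \<in> I" for i
    using that domI by (cases i) (auto simp: X_def intro!: Z_diff_measurable)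
  have X_exp: "(\<integral>\<^sup>+\<omega>. ennreal (exp ((X i \<omega>)\<^sup>2 / (4 * \<sigma>\<^sup>2))) \<partial>P) \<le> 2" if i: "i \<in> I" for i
  proof (cases i)
    case (Pair p q)
    have "L2_norm N (\<lambda>y. Q p y - Q q y) \<le> \<sigma>"
      unfolding \<sigma>_def using i Pair u by (intro norm_Q_Net_diff_le) (auto simp: I_def)
    then have "(L2_norm N (\<lambda>y. Q p y - Q q y))\<^sup>2 \<le> \<sigma>\<^sup>2" by (intro power_mono) auto
    then show ?thesis
      using centered_gaussian_exp_square[OF P_prob Z_diff_gaussian[of p q]] domI i Pair \<sigma>
      by (simp add: X_def)
  qed
  have "finite I" using fin sub finite_subset by blast
  then obtain U where U: "U \<in> borel_measurable P" "\<And>\<omega>. 0 \<le> U \<omega>"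
    "\<And>i \<omega>. i \<in> I \<Longrightarrow> X i \<omega> ^ 4 \<le> U \<omega>"
    "(\<integral>\<^sup>+\<omega>. ennreal (U \<omega>) \<partial>P) \<le> ennreal (16 * \<sigma> ^ 4 * (2 * L\<^sup>2 + 8))"
    by (rule fourth_power_maximal[where X = X and P = P, OF _ card L0 \<sigma>])
       (use X_meas X_exp P_prob in blast)+
  note U(4)
  also have "ennreal (16 * \<sigma> ^ 4 * (2 * L\<^sup>2 + 8)) \<le> ennreal (800 * level u ^ 4)"
  proof (intro ennreal_leI)
    let ?s = "sqrt_entropy u"
    have "1 + ?s ^ 4 \<le> (1 + ?s) ^ 4"
      by (simp add: power4_eq_xxxx algebra_simps)
    \<comment> \<open>The left side is \<open>800 * ?s ^ 4 + 128\<close>, which is the origin of the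
      constant 800.\<close>
    then have "16 * (2 * L\<^sup>2 + 8) \<le> 800 * (1 + ?s) ^ 4"
      by (simp add: L_def power_mult_distrib flip: power_mult)
    then have "\<sigma> ^ 4 * (16 * (2 * L\<^sup>2 + 8)) \<le> \<sigma> ^ 4 * (800 * (1 + ?s) ^ 4)"
      using \<sigma> by (intro mult_left_mono) auto
    then show "16 * \<sigma> ^ 4 * (2 * L\<^sup>2 + 8) \<le> 800 * level u ^ 4"
      by (simp add: level_def \<sigma>_def power_mult_distrib mult_ac)
  qed
  finally show ?thesis
    using U(1,2) U(3)[of "(p, q)" for p q]
    by (intro exI[of _ U]) (auto simp: level_bound_def X_def I_def)
qed

text \<open>The entropy-free parts form a geometric series of order
  \<open>\<delta> powr (1 - a)\<close>, absorbed by \<open>powr_le_G\<close>; the entropy parts are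
  handled by \<open>integrand_sum_le\<close>.\<close>

lemma level_sum_le:
  obtains K where "0 < K"
    "\<And>\<delta> n. 0 < \<delta> \<Longrightarrow> \<delta> \<le> B2 \<Longrightarrow> (\<Sum>k<n. level (\<delta> / 2 ^ k)) \<le> K * G \<delta>"
proof -
  obtain K0 where K0: "0 < K0" "\<And>\<delta>. 0 < \<delta> \<Longrightarrow> \<delta> \<le> B2 \<Longrightarrow> \<delta> powr (1 - a) \<le> K0 * G \<delta>"
    using powr_le_G by blast
  define K where "K = 12 * c / (1 - r) * K0 + 24"
  have "(\<Sum>k<n. level (\<delta> / 2 ^ k)) \<le> K * G \<delta>" if \<delta>: "0 < \<delta>" "\<delta> \<le> B2" for \<delta> n
  proof -
    have "\<delta> / 2 ^ k \<le> \<delta>" for k using \<delta> by (simp add: divide_le_eq)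
    then have "\<delta> / 2 ^ k \<in> {0<..B2}" for k using \<delta> order_trans by auto
    then have "(\<Sum>k<n. level (\<delta> / 2 ^ k)) = 12 * c * (\<Sum>k\<in>{0..<n}. (\<delta> / 2 ^ k) powr (1 - a))
        + 12 * (\<Sum>k<n. \<delta> / 2 ^ k * h (\<delta> / 2 ^ k))"
      by (simp add: level_eq sum.distrib sum_distrib_left lessThan_atLeast0 mult_ac)
    also have "\<dots> \<le> 12 * c * (\<delta> powr (1 - a) * (r ^ 0 / (1 - r))) + 12 * (2 * G \<delta>)"
      using c_pos \<delta> by (intro add_mono mult_left_mono halving_sum_le integrand_sum_le) auto
    also have "\<dots> = 12 * c / (1 - r) * \<delta> powr (1 - a) + 24 * G \<delta>" by simp
    also have "\<dots> \<le> 12 * c / (1 - r) * (K0 * G \<delta>) + 24 * G \<delta>"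
      using K0(2)[OF \<delta>] c_pos r_range by (intro add_right_mono mult_left_mono) auto
    also have "\<dots> = K * G \<delta>" by (simp add: K_def algebra_simps)
    finally show ?thesis .
  qed
  moreover have "0 < K" using K0 c_pos r_range by (simp add: K_def add_pos_pos)
  ultimately show ?thesis using that by blast
qed

text \<open>The images under \<open>Q\<close> of the chain of \<open>f\<close> move by geometrically
  decreasing amounts. Closedness, in the form of \<open>norm_Q_diff_limit_le\<close>, carries the
  bound on the tail over to \<open>Q f\<close>, although \<open>f\<close> itself lies in no
  prescribed net.\<close>

lemma norm_Q_near_diff_le:
  assumes \<delta>: "0 < \<delta>" "2 * \<delta> \<le> B2" and f: "f \<in> F"
  shows "L2_norm N (\<lambda>y. Q (near (2 * \<delta> / 2 ^ k) f) y - Q f y)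
    \<le> 3 * c * \<delta> powr (1 - a) * (r ^ k / (1 - r))"
proof -
  let ?\<phi> = "\<lambda>k. near (2 * \<delta> / 2 ^ k) f"
  have pos: "0 < 2 * \<delta> / 2 ^ k" for k using \<delta> by simp
  have dom: "?\<phi> k \<in> domQ" "f \<in> domQ" for k
    using near(3)[OF pos f] F_dom f by auto
  have step_le: "L2_norm N (\<lambda>y. Q (?\<phi> (Suc l)) y - Q (?\<phi> l) y) \<le> 3 * c * (\<delta> / 2 ^ l) powr (1 - a)" for l
  proof (rule norm_Q_Net_diff_le)
    have "\<delta> / 2 ^ l \<le> \<delta>" using \<delta> by (simp add: divide_le_eq)
    then show "\<delta> / 2 ^ l \<in> {0<..B2}" using \<delta> by auto
    show "?\<phi> (Suc l) \<in> Net (\<delta> / 2 ^ l)" "?\<phi> l \<in> Net (2 * (\<delta> / 2 ^ l))"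
      using near(1)[OF pos[of "Suc l"] f] near(1)[OF pos[of l] f] by simp_all
    \<comment> \<open>Here \<open>3 = 1 + 2\<close>: two approximations of the same
      \<open>f\<close>, at resolutions \<open>\<delta> / 2 ^ l\<close> and twice that.\<close>
    show "L2_norm M (\<lambda>x. ?\<phi> (Suc l) x - ?\<phi> l x) \<le> 3 * (\<delta> / 2 ^ l)"
      using norm_near_diff_le[OF pos[of "Suc l"] f pos[of l] f] by (simp add: L2_norm_def)
  qed
  have "L2_norm N (\<lambda>y. Q (?\<phi> k) y - Q (?\<phi> m) y) \<le> (\<Sum>l\<in>{k..<m}. 3 * c * (\<delta> / 2 ^ l) powr (1 - a))"
    if "k \<le> m" for m
    using that
  proof (induction m rule: dec_induct)
    case base
    show ?case by (simp add: L2_norm_def)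
  next
    case (step m)
    have "L2_norm N (\<lambda>y. Q (?\<phi> k) y - Q (?\<phi> (Suc m)) y)
        \<le> L2_norm N (\<lambda>y. Q (?\<phi> k) y - Q (?\<phi> m) y) + L2_norm N (\<lambda>y. Q (?\<phi> m) y - Q (?\<phi> (Suc m)) y)"
      by (intro L2_norm_triangle Q_L2 dom)
    then show ?case
      using step step_le[of m]
        L2_norm_minus_commute[of N "Q (?\<phi> m)" "Q (?\<phi> (Suc m))"]
      by simp
  qed
  moreover have "(\<Sum>l\<in>{k..<m}. 3 * c * (\<delta> / 2 ^ l) powr (1 - a))
      \<le> 3 * c * \<delta> powr (1 - a) * (r ^ k / (1 - r))" for m
    using mult_left_mono[OF halving_sum_le[OF \<delta>(1), of k m], of "3 * c"] c_pos
    unfolding sum_distrib_left[symmetric] by (simp only: mult.assoc)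
  ultimately have "L2_norm N (\<lambda>y. Q (?\<phi> k) y - Q (?\<phi> m) y)
      \<le> 3 * c * \<delta> powr (1 - a) * (r ^ k / (1 - r))" if "k \<le> m" for m
    using that order_trans by blast
  moreover have "(\<lambda>m. L2_norm M (\<lambda>x. ?\<phi> m x - f x)) \<longlonglongrightarrow> 0"
  proof (rule tendsto_sandwich)
    show "\<forall>\<^sub>F m in sequentially. 0 \<le> L2_norm M (\<lambda>x. ?\<phi> m x - f x)" by simp
    show "\<forall>\<^sub>F m in sequentially. L2_norm M (\<lambda>x. ?\<phi> m x - f x) \<le> 2 * \<delta> / 2 ^ m"
      using near(2)[OF pos f] L2_norm_minus_commute[of M _ f] by (intro always_eventually) simp
    show "(\<lambda>m. 2 * \<delta> / 2 ^ m) \<longlonglongrightarrow> 0"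
      using LIMSEQ_divide_realpow_zero[of 2 "2 * \<delta>"] by simp
  qed simp
  ultimately show ?thesis
    using c_pos r_range
    by (intro norm_Q_diff_limit_le[where \<phi> = ?\<phi>] dom)
       (auto simp: eventually_sequentially)
qed

text \<open>The variances are bounded by a multiple of \<open>(r\<^sup>2) ^ k\<close>, so the second
  moments are summable. The exceptional null set depends on \<open>f\<close>, which is why
  separability is needed to reach all of \<open>F\<close>.\<close>

lemma AE_Z_near_tendsto:
  assumes \<delta>: "0 < \<delta>" "2 * \<delta> \<le> B2" and f: "f \<in> F"
  shows "AE \<omega> in P. (\<lambda>k. Z (near (2 * \<delta> / 2 ^ k) f) \<omega>) \<longlonglongrightarrow> Z f \<omega>"
proof -
  let ?\<phi> = "\<lambda>k. near (2 * \<delta> / 2 ^ k) f"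
  define s where "s k = 3 * c * \<delta> powr (1 - a) * (r ^ k / (1 - r))" for k
  have dom: "?\<phi> k \<in> domQ" "f \<in> domQ" for k
    using near(3)[of "2 * \<delta> / 2 ^ k" f] \<delta> F_dom f by auto
  have s_pos: "0 < s k" for k using c_pos r_range \<delta> by (simp add: s_def)
  have "AE \<omega> in P. (\<lambda>k. Z (?\<phi> k) \<omega> - Z f \<omega>) \<longlonglongrightarrow> 0"
  proof (rule AE_tendsto_0_of_second_moments)
    fix k
    show "(\<lambda>\<omega>. Z (?\<phi> k) \<omega> - Z f \<omega>) \<in> borel_measurable P"
      by (intro Z_diff_measurable dom)
    have "(L2_norm N (\<lambda>y. Q (?\<phi> k) y - Q f y))\<^sup>2 \<le> (s k)\<^sup>2"
      unfolding s_def using norm_Q_near_diff_le[OF \<delta> f] by (intro power_mono) auto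
    then show "(\<integral>\<^sup>+\<omega>. ennreal ((Z (?\<phi> k) \<omega> - Z f \<omega>)\<^sup>2) \<partial>P) \<le> ennreal (8 * (s k)\<^sup>2)"
      by (intro centered_gaussian_second_moment[OF P_prob Z_diff_gaussian[OF dom] _ s_pos])
    show "0 \<le> 8 * (s k)\<^sup>2" by simp
  next
    have "summable (\<lambda>k. 8 * (3 * c * \<delta> powr (1 - a) / (1 - r))\<^sup>2 * (r\<^sup>2) ^ k)"
      using r_range by (intro summable_mult summable_geometric) (simp add: power_less_one_iff)
    then show "summable (\<lambda>k. 8 * (s k)\<^sup>2)"
      by (simp add: s_def power_mult_distrib power_divide power_mult[symmetric] mult_ac)
  qed
  then show ?thesis by eventually_elim (simp add: LIM_zero_iff)
qed

text \<open>The chains of two points are joined at the coarsest level, every link is controlled by a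
  \<open>level_bound\<close>, and Hoelder's inequality adds up the fourth powers. The estimate is
  proved on a countable set on which all chains converge and extended to \<open>F\<close> by
  separability.\<close>

lemma chaining:
  obtains K where "0 < K"
    "\<And>\<delta>. 0 < \<delta> \<Longrightarrow> 2 * \<delta> \<le> B2 \<Longrightarrow>
      \<exists>S :: 'w \<Rightarrow> ennreal. S \<in> borel_measurable P \<and>
        (AE \<omega> in P. \<forall>f\<in>F. \<forall>g\<in>F. L2_norm M (\<lambda>x. f x - g x) \<le> 8 * \<delta> \<longrightarrow>
          ennreal ((Z f \<omega> - Z g \<omega>) ^ 4) \<le> S \<omega>) \<and>
        (\<integral>\<^sup>+\<omega>. S \<omega> \<partial>P) \<le> ennreal (K * G \<delta> ^ 4)"
proof -
  obtain K1 where K1: "0 < K1"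
    "\<And>\<delta> n. 0 < \<delta> \<Longrightarrow> \<delta> \<le> B2 \<Longrightarrow> (\<Sum>k<n. level (\<delta> / 2 ^ k)) \<le> K1 * G \<delta>"
    using level_sum_le by blast
  define K where "K = 16 * 800 * K1 ^ 4"
  have "\<exists>S :: 'w \<Rightarrow> ennreal. S \<in> borel_measurable P \<and>
        (AE \<omega> in P. \<forall>f\<in>F. \<forall>g\<in>F. L2_norm M (\<lambda>x. f x - g x) \<le> 8 * \<delta> \<longrightarrow>
          ennreal ((Z f \<omega> - Z g \<omega>) ^ 4) \<le> S \<omega>) \<and>
        (\<integral>\<^sup>+\<omega>. S \<omega> \<partial>P) \<le> ennreal (K * G \<delta> ^ 4)"
    if \<delta>: "0 < \<delta>" "2 * \<delta> \<le> B2" for \<delta>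
  proof -
    define u where "u k = \<delta> / 2 ^ k" for k :: nat
    define b where "b k = level (u k)" for k
    define B where "B = K1 * G \<delta>"
    have u: "0 < u k" "2 * u k \<le> B2" for k
    proof -
      have "u k \<le> \<delta>" using \<delta> by (simp add: u_def divide_le_eq)
      then show "0 < u k" "2 * u k \<le> B2" using \<delta> by (auto simp: u_def)
    qed
    have b: "0 < b k" for k using u by (simp add: b_def level_pos)
    have b_sum: "(\<Sum>k<n. b k) \<le> B" for n
      using K1(2)[of \<delta> n] \<delta> by (simp add: b_def u_def B_def)
    have B: "0 \<le> B" using b_sum[of 0] by simp
    obtain U where level_U: "\<And>k. level_bound (u k) (U k)"
      using ex_level_bound[OF u] by metis
    have U: "U k \<in> borel_measurable P" "0 \<le> U k \<omega>"
      "p \<in> Net (u k) \<Longrightarrow> q \<in> Net (2 * u k) \<Longrightarrow>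
        L2_norm M (\<lambda>x. p x - q x) \<le> 12 * u k \<Longrightarrow> (Z p \<omega> - Z q \<omega>) ^ 4 \<le> U k \<omega>"
      "(\<integral>\<^sup>+\<omega>. ennreal (U k \<omega>) \<partial>P) \<le> ennreal (800 * b k ^ 4)" for k p q \<omega>
      using level_U[of k] unfolding level_bound_def b_def by auto
    \<comment> \<open>\<open>16 = 2 ^ 4\<close> stems from the factor 2 in
      \<open>abs_diff_le_links\<close>, and \<open>B ^ 3 / b k ^ 3\<close> from
      \<open>sum_power4_le\<close>. As \<open>U k\<close> has expectation at most
      \<open>800 * b k ^ 4\<close>, term \<open>k\<close> contributes at most
      \<open>16 * 800 * B ^ 3 * b k\<close>, and the total is of order \<open>B ^ 4\<close>.\<close>
    define S where "S = (\<lambda>\<omega>. \<Sum>k. ennreal (16 * B ^ 3 / b k ^ 3) * ennreal (U k \<omega>))"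
    have coef: "0 \<le> 16 * B ^ 3 / b k ^ 3" for k using B b[of k] by simp
    have S_meas: "S \<in> borel_measurable P" unfolding S_def using U(1) by measurable
    have partial: "ennreal ((2 * (\<Sum>k\<le>n. root 4 (U k \<omega>))) ^ 4) \<le> S \<omega>" for n \<omega>
    proof -
      have "(2 * (\<Sum>k\<le>n. root 4 (U k \<omega>))) ^ 4
          \<le> 16 * ((\<Sum>k\<le>n. b k) ^ 3 * (\<Sum>k\<le>n. root 4 (U k \<omega>) ^ 4 / b k ^ 3))"
        using sum_power4_le[of "{..n}" b "\<lambda>k. root 4 (U k \<omega>)"] b by (simp add: power_mult_distrib)
      also have "\<dots> \<le> 16 * (B ^ 3 * (\<Sum>k\<le>n. U k \<omega> / b k ^ 3))"
        using b_sum[of "Suc n"] b U(2)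
        by (intro mult_left_mono mult_mono power_mono)
           (auto intro!: sum_nonneg less_imp_le[OF b] divide_nonneg_nonneg simp: lessThan_Suc_atMost B)
      also have "\<dots> = (\<Sum>k\<le>n. 16 * B ^ 3 / b k ^ 3 * U k \<omega>)"
        by (simp add: sum_distrib_left mult.assoc)
      finally have "ennreal ((2 * (\<Sum>k\<le>n. root 4 (U k \<omega>))) ^ 4)
          \<le> ennreal (\<Sum>k\<le>n. 16 * B ^ 3 / b k ^ 3 * U k \<omega>)" by (rule ennreal_leI)
      also have "\<dots> = (\<Sum>k\<le>n. ennreal (16 * B ^ 3 / b k ^ 3 * U k \<omega>))"
        using coef U(2) by (intro sum_ennreal[symmetric] mult_nonneg_nonneg)
      also have "\<dots> = (\<Sum>k\<le>n. ennreal (16 * B ^ 3 / b k ^ 3) * ennreal (U k \<omega>))"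
        by (intro sum.cong refl ennreal_mult coef U(2))
      also have "\<dots> \<le> S \<omega>"
        unfolding S_def by (intro sum_le_suminf) auto
      finally show ?thesis .
    qed
    obtain T where T: "countable T" "T \<subseteq> F"
      "AE \<omega> in P. \<forall>g\<in>F. \<forall>\<eta>>0. \<exists>s\<in>T. L2_norm M (\<lambda>x. s x - g x) < \<eta> \<and> \<bar>Z s \<omega> - Z g \<omega>\<bar> < \<eta>"
      using separable unfolding separable_process_def by blast
    \<comment> \<open>Countability of \<open>T\<close> yields one null set outside which all these
      chains converge.\<close>
    have "AE \<omega> in P. \<forall>s\<in>T. (\<lambda>k. Z (near (2 * \<delta> / 2 ^ k) s) \<omega>) \<longlonglongrightarrow> Z s \<omega>"
      using T(1,2) by (subst AE_ball_countable) (auto intro!: AE_Z_near_tendsto \<delta>)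
    with T(3) have "AE \<omega> in P. \<forall>f\<in>F. \<forall>g\<in>F. L2_norm M (\<lambda>x. f x - g x) \<le> 8 * \<delta> \<longrightarrow>
        ennreal ((Z f \<omega> - Z g \<omega>) ^ 4) \<le> S \<omega>"
    proof eventually_elim
      fix \<omega>
      assume dense: "\<forall>g\<in>F. \<forall>\<eta>>0. \<exists>s\<in>T. L2_norm M (\<lambda>x. s x - g x) < \<eta> \<and> \<bar>Z s \<omega> - Z g \<omega>\<bar> < \<eta>"
        and lim: "\<forall>s\<in>T. (\<lambda>k. Z (near (2 * \<delta> / 2 ^ k) s) \<omega>) \<longlonglongrightarrow> Z s \<omega>"
      \<comment> \<open>The radius \<open>9 * \<delta>\<close> instead of
        \<open>8 * \<delta>\<close> leaves room for moving each of two points by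
        \<open>\<delta> / 2\<close>.\<close>
      have T_le: "ennreal ((Z s \<omega> - Z t \<omega>) ^ 4) \<le> S \<omega>"
        if st: "s \<in> T" "t \<in> T" "L2_norm M (\<lambda>x. s x - t x) \<le> 9 * \<delta>" for s t
      proof -
        let ?x = "\<lambda>k. Z (near (2 * \<delta> / 2 ^ k) s) \<omega>" and ?y = "\<lambda>k. Z (near (2 * \<delta> / 2 ^ k) t) \<omega>"
        have pos: "0 < 2 * \<delta> / 2 ^ k" for k using \<delta> by simp
        have link: "\<bar>Z p \<omega> - Z q \<omega>\<bar> \<le> root 4 (U k \<omega>)"
          if "p \<in> Net (u k)" "q \<in> Net (2 * u k)" "L2_norm M (\<lambda>x. p x - q x) \<le> 12 * u k" for p q k
        proof -
          have "\<bar>Z p \<omega> - Z q \<omega>\<bar> = root 4 ((Z p \<omega> - Z q \<omega>) ^ 4)"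
            using real_root_power_cancel[of 4 "\<bar>Z p \<omega> - Z q \<omega>\<bar>"] by (simp add: power_even_abs)
          also have "\<dots> \<le> root 4 (U k \<omega>)" by (intro real_root_le_mono U(3) that) simp
          finally show ?thesis .
        qed
        have step: "\<bar>Z (near (2 * \<delta> / 2 ^ Suc k) f) \<omega> - Z (near (2 * \<delta> / 2 ^ k) f) \<omega>\<bar>
            \<le> root 4 (U k \<omega>)" if f: "f \<in> F" for f k
        proof (rule link)
          show "near (2 * \<delta> / 2 ^ Suc k) f \<in> Net (u k)" "near (2 * \<delta> / 2 ^ k) f \<in> Net (2 * u k)"
            using near(1)[OF pos[of "Suc k"] f] near(1)[OF pos[of k] f] by (simp_all add: u_def)
          show "L2_norm M (\<lambda>x. near (2 * \<delta> / 2 ^ Suc k) f x - near (2 * \<delta> / 2 ^ k) f x) \<le> 12 * u k"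
            using norm_near_diff_le[OF pos[of "Suc k"] f pos[of k] f] u[of k]
            by (simp add: L2_norm_def u_def)
        qed
        have F: "s \<in> F" "t \<in> F" using st T by auto
        have "\<bar>?x 1 - ?y 0\<bar> \<le> root 4 (U 0 \<omega>)"
        proof (rule link)
          show "near (2 * \<delta> / 2 ^ 1) s \<in> Net (u 0)" "near (2 * \<delta> / 2 ^ 0) t \<in> Net (2 * u 0)"
            using near(1)[OF pos[of 1] F(1)] near(1)[OF pos[of 0] F(2)] by (simp_all add: u_def)
          show "L2_norm M (\<lambda>x. near (2 * \<delta> / 2 ^ 1) s x - near (2 * \<delta> / 2 ^ 0) t x) \<le> 12 * u 0"
            using norm_near_diff_le[OF pos[of 1] F(1) pos[of 0] F(2)] st(3) by (simp add: u_def)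
        qed
        then have "\<bar>?x (Suc n) - ?y (Suc n)\<bar> \<le> 2 * (\<Sum>k\<le>n. root 4 (U k \<omega>))" for n
          by (intro abs_diff_le_links step F)
        then have "\<bar>?x (Suc n) - ?y (Suc n)\<bar> ^ 4 \<le> (2 * (\<Sum>k\<le>n. root 4 (U k \<omega>))) ^ 4" for n
          by (intro power_mono) auto
        then have "(?x (Suc n) - ?y (Suc n)) ^ 4 \<le> (2 * (\<Sum>k\<le>n. root 4 (U k \<omega>))) ^ 4" for n
          by (simp only: power_even_abs even_numeral)
        then have le: "ennreal ((?x (Suc n) - ?y (Suc n)) ^ 4) \<le> S \<omega>" for n
          by (rule order_trans[OF ennreal_leI partial])
        have "(\<lambda>n. ennreal ((?x (Suc n) - ?y (Suc n)) ^ 4)) \<longlonglongrightarrow> ennreal ((Z s \<omega> - Z t \<omega>) ^ 4)"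
          using lim st by (intro tendsto_ennrealI tendsto_power tendsto_diff LIMSEQ_Suc) auto
        then show ?thesis
          by (rule LIMSEQ_le_const2) (use le in auto)
      qed
      show "\<forall>f\<in>F. \<forall>g\<in>F. L2_norm M (\<lambda>x. f x - g x) \<le> 8 * \<delta> \<longrightarrow>
        ennreal ((Z f \<omega> - Z g \<omega>) ^ 4) \<le> S \<omega>"
      proof (intro ballI impI)
        fix f g assume fg: "f \<in> F" "g \<in> F" "L2_norm M (\<lambda>x. f x - g x) \<le> 8 * \<delta>"
        define \<eta> where "\<eta> m = min (\<delta> / 2) (inverse (real (Suc m)))" for m
        have \<eta>: "0 < \<eta> m" "\<eta> m \<le> \<delta> / 2" for m using \<delta> by (auto simp: \<eta>_def)
        have \<eta>_lim: "\<eta> \<longlonglongrightarrow> 0"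
          by (rule tendsto_sandwich[OF _ _ tendsto_const LIMSEQ_inverse_real_of_nat])
             (use \<delta> in \<open>auto simp: \<eta>_def\<close>)
        have approx: "\<forall>m. \<exists>s. s \<in> T \<and> L2_norm M (\<lambda>x. s x - k x) < \<eta> m \<and> \<bar>Z s \<omega> - Z k \<omega>\<bar> < \<eta> m"
          if "k \<in> F" for k
        proof
          fix m
          show "\<exists>s. s \<in> T \<and> L2_norm M (\<lambda>x. s x - k x) < \<eta> m \<and> \<bar>Z s \<omega> - Z k \<omega>\<bar> < \<eta> m"
            using dense[rule_format, OF that \<eta>(1)[of m]] by blast
        qed
        from approx[OF fg(1), THEN choice] obtain s where
          s: "\<And>m. s m \<in> T" "\<And>m. L2_norm M (\<lambda>x. s m x - f x) < \<eta> m" "\<And>m. \<bar>Z (s m) \<omega> - Z f \<omega>\<bar> < \<eta> m"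
          by blast
        from approx[OF fg(2), THEN choice] obtain t where
          t: "\<And>m. t m \<in> T" "\<And>m. L2_norm M (\<lambda>x. t m x - g x) < \<eta> m" "\<And>m. \<bar>Z (t m) \<omega> - Z g \<omega>\<bar> < \<eta> m"
          by blast
        have to: "(\<lambda>m. Z (s m) \<omega>) \<longlonglongrightarrow> Z k \<omega>" if "\<And>m. \<bar>Z (s m) \<omega> - Z k \<omega>\<bar> < \<eta> m" for s k
          by (rule LIM_zero_cancel, rule Lim_null_comparison[OF _ \<eta>_lim])
             (use that in \<open>auto intro!: always_eventually less_imp_le\<close>)
        have le: "ennreal ((Z (s m) \<omega> - Z (t m) \<omega>) ^ 4) \<le> S \<omega>" for m
        proof (rule T_le[OF s(1) t(1)])
          have L2: "s m \<in> L2_fun M" "t m \<in> L2_fun M" "f \<in> L2_fun M" "g \<in> L2_fun M"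
            using s(1) t(1) T(2) fg F_L2 by auto
          show "L2_norm M (\<lambda>x. s m x - t m x) \<le> 9 * \<delta>"
            using L2_norm_triangle[OF L2(1,3,2)] L2_norm_triangle[OF L2(3,4,2)]
              L2_norm_minus_commute[of M g "t m"] s(2)[of m] t(2)[of m] fg(3) \<eta>(2)[of m] by linarith
        qed
        have "(\<lambda>m. ennreal ((Z (s m) \<omega> - Z (t m) \<omega>) ^ 4)) \<longlonglongrightarrow> ennreal ((Z f \<omega> - Z g \<omega>) ^ 4)"
          using to[OF s(3)] to[OF t(3)] by (intro tendsto_ennrealI tendsto_power tendsto_diff)
        then show "ennreal ((Z f \<omega> - Z g \<omega>) ^ 4) \<le> S \<omega>"
          by (rule LIMSEQ_le_const2) (use le in auto)
      qed
    qed
    moreover have "(\<integral>\<^sup>+\<omega>. S \<omega> \<partial>P) \<le> ennreal (K * G \<delta> ^ 4)"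
    proof -
      have "(\<integral>\<^sup>+\<omega>. S \<omega> \<partial>P) = (\<Sum>k. \<integral>\<^sup>+\<omega>. ennreal (16 * B ^ 3 / b k ^ 3) * ennreal (U k \<omega>) \<partial>P)"
        unfolding S_def using U(1) by (intro nn_integral_suminf) measurable
      also have "\<dots> = (\<Sum>k. ennreal (16 * B ^ 3 / b k ^ 3) * (\<integral>\<^sup>+\<omega>. ennreal (U k \<omega>) \<partial>P))"
        using U(1) by (intro suminf_cong nn_integral_cmult) measurable
      also have "\<dots> \<le> (\<Sum>k. ennreal (16 * 800 * B ^ 3 * b k))"
      proof (intro suminf_le allI)
        fix k
        have "ennreal (16 * B ^ 3 / b k ^ 3) * (\<integral>\<^sup>+\<omega>. ennreal (U k \<omega>) \<partial>P)
            \<le> ennreal (16 * B ^ 3 / b k ^ 3) * ennreal (800 * b k ^ 4)"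
          by (intro mult_left_mono U(4)) simp
        also have "\<dots> = ennreal (16 * B ^ 3 / b k ^ 3 * (800 * b k ^ 4))"
          by (rule ennreal_mult'[symmetric, OF coef])
        also have "16 * B ^ 3 / b k ^ 3 * (800 * b k ^ 4) = 16 * 800 * B ^ 3 * b k"
          using b[of k] by (simp add: field_simps power4_eq_xxxx power3_eq_cube)
        finally show "ennreal (16 * B ^ 3 / b k ^ 3) * (\<integral>\<^sup>+\<omega>. ennreal (U k \<omega>) \<partial>P)
            \<le> ennreal (16 * 800 * B ^ 3 * b k)" .
      qed auto
      also have "\<dots> \<le> ennreal (16 * 800 * B ^ 3 * B)"
      proof (rule suminf_le_const[OF summableI])
        fix n
        have "(\<Sum>k<n. ennreal (16 * 800 * B ^ 3 * b k)) = ennreal (16 * 800 * B ^ 3 * (\<Sum>k<n. b k))"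
          using B b by (simp add: sum_ennreal less_imp_le sum_distrib_left)
        also have "\<dots> \<le> ennreal (16 * 800 * B ^ 3 * B)"
          using B b_sum by (intro ennreal_leI mult_left_mono) auto
        finally show "(\<Sum>k<n. ennreal (16 * 800 * B ^ 3 * b k)) \<le> ennreal (16 * 800 * B ^ 3 * B)" .
      qed
      also have "16 * 800 * B ^ 3 * B = K * G \<delta> ^ 4"
        by (simp add: K_def B_def power4_eq_xxxx power3_eq_cube)
      finally show ?thesis .
    qed
    ultimately show ?thesis using S_meas by blast
  qed
  moreover have "0 < K" using K1 by (simp add: K_def)
  ultimately show ?thesis using that by blast
qed

end

section \<open>The risk bound\<close>

context white_noise_problem
begin

text \<open>The shell decomposition. The constant is fixed before the sample size, the rate, the
  true function, \<open>\<epsilon>\<close> and the estimator, so the bound is uniform in all of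
  them.\<close>

lemma expectation_le:
  assumes F_bounded: "\<forall>g\<in>F. L2_norm M g \<le> B2" and C_pos: "0 < C"
  obtains K where "0 < K"
    "\<And>n \<psi> f \<epsilon> fhat. 0 < \<psi> \<Longrightarrow> \<psi> \<le> B2 \<Longrightarrow> C * real n powr (-1/2) * G \<psi> \<le> \<psi>\<^sup>2 \<Longrightarrow>
      f \<in> F \<Longrightarrow> 0 < \<epsilon> \<Longrightarrow> \<forall>\<omega>\<in>space P. fhat \<omega> \<in> F \<Longrightarrow>
      (\<lambda>\<omega>. L2_norm M (\<lambda>x. fhat \<omega> x - f x)) \<in> borel_measurable P \<Longrightarrow>
      AE \<omega> in P. near_minimizer M N A Q W n f F \<epsilon> (fhat \<omega>) \<omega> \<Longrightarrow>
      prob_space.expectation P (\<lambda>\<omega>. (L2_norm M (\<lambda>x. fhat \<omega> x - f x))\<^sup>2) \<le> K * (\<psi>\<^sup>2 + \<epsilon>)"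
proof -
  interpret P: prob_space P by (rule P_prob)
  obtain K where K: "0 < K"
    "\<And>\<delta>. 0 < \<delta> \<Longrightarrow> 2 * \<delta> \<le> B2 \<Longrightarrow>
      \<exists>S :: 'w \<Rightarrow> ennreal. S \<in> borel_measurable P \<and>
        (AE \<omega> in P. \<forall>f\<in>F. \<forall>g\<in>F. L2_norm M (\<lambda>x. f x - g x) \<le> 8 * \<delta> \<longrightarrow>
          ennreal ((Z f \<omega> - Z g \<omega>) ^ 4) \<le> S \<omega>) \<and>
        (\<integral>\<^sup>+\<omega>. S \<omega> \<partial>P) \<le> ennreal (K * G \<delta> ^ 4)"
    using chaining by blast
  have "prob_space.expectation P (\<lambda>\<omega>. (L2_norm M (\<lambda>x. fhat \<omega> x - f x))\<^sup>2)
      \<le> (66 + K / C ^ 4) * (\<psi>\<^sup>2 + \<epsilon>)"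
    if \<psi>: "0 < \<psi>" "\<psi> \<le> B2" and rate: "C * real n powr (-1/2) * G \<psi> \<le> \<psi>\<^sup>2"
      and f: "f \<in> F" and \<epsilon>: "0 < \<epsilon>" and fhat: "\<forall>\<omega>\<in>space P. fhat \<omega> \<in> F"
      and meas: "(\<lambda>\<omega>. L2_norm M (\<lambda>x. fhat \<omega> x - f x)) \<in> borel_measurable P"
      and min: "AE \<omega> in P. near_minimizer M N A Q W n f F \<epsilon> (fhat \<omega>) \<omega>"
    for n \<psi> f \<epsilon> fhat
  proof -
    define D where "D \<omega> = L2_norm M (\<lambda>x. fhat \<omega> x - f x)" for \<omega>
    define s where "s = real n powr (-1/2)"
    define \<delta> where "\<delta> j = 2 ^ j * \<psi>" for j :: nat
    \<comment> \<open>The indices at which \<open>chaining\<close> applies. No other shell occurs: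
      on the shell of index \<open>j\<close> one has \<open>4 * \<delta> j < D \<omega>\<close>, and
      \<open>D \<omega>\<close> is at most \<open>2 * B2\<close>.\<close>
    define J where "J = {j. 2 * \<delta> j \<le> B2}"
    \<comment> \<open>Dividing \<open>D \<omega> ^ 8 \<le> 256 * s ^ 4 * X ^ 4\<close> by
      \<open>D \<omega> ^ 6\<close>, which is at least \<open>(4 * \<delta> j) ^ 6\<close>, leaves
      the factor \<open>256 / 4 ^ 6 = 1 / 16\<close>.\<close>
    define q where "q j = s ^ 4 / (16 * \<delta> j ^ 6)" for j
    have s: "0 \<le> s" by (simp add: s_def)
    have \<delta>: "0 < \<delta> j" for j using \<psi> by (simp add: \<delta>_def)
    have q: "0 \<le> q j" for j using s \<delta>[of j] by (simp add: q_def)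
    have "\<forall>j\<in>J. \<exists>S :: 'w \<Rightarrow> ennreal. S \<in> borel_measurable P \<and>
        (AE \<omega> in P. \<forall>f\<in>F. \<forall>g\<in>F. L2_norm M (\<lambda>x. f x - g x) \<le> 8 * \<delta> j \<longrightarrow>
          ennreal ((Z f \<omega> - Z g \<omega>) ^ 4) \<le> S \<omega>) \<and>
        (\<integral>\<^sup>+\<omega>. S \<omega> \<partial>P) \<le> ennreal (K * G (\<delta> j) ^ 4)"
      using K(2) \<delta> by (auto simp: J_def)
    from bchoice[OF this] obtain S :: "nat \<Rightarrow> 'w \<Rightarrow> ennreal" where
      S: "\<forall>j\<in>J. S j \<in> borel_measurable P \<and>
        (AE \<omega> in P. \<forall>f\<in>F. \<forall>g\<in>F. L2_norm M (\<lambda>x. f x - g x) \<le> 8 * \<delta> j \<longrightarrow>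
          ennreal ((Z f \<omega> - Z g \<omega>) ^ 4) \<le> S j \<omega>) \<and>
        (\<integral>\<^sup>+\<omega>. S j \<omega> \<partial>P) \<le> ennreal (K * G (\<delta> j) ^ 4)"
      by blast
    define R where "R = (\<lambda>\<omega>. \<Sum>j. ennreal (q j) * (if j \<in> J then S j \<omega> else 0))"
    have S_meas: "(\<lambda>\<omega>. if j \<in> J then S j \<omega> else 0) \<in> borel_measurable P" for j
      using S by (cases "j \<in> J") auto
    have S_AE: "AE \<omega> in P. \<forall>j\<in>J. \<forall>f\<in>F. \<forall>g\<in>F. L2_norm M (\<lambda>x. f x - g x) \<le> 8 * \<delta> j \<longrightarrow>
          ennreal ((Z f \<omega> - Z g \<omega>) ^ 4) \<le> S j \<omega>"
      using S by (subst AE_ball_countable) auto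
    have "AE \<omega> in P. ennreal ((D \<omega>)\<^sup>2) \<le> ennreal (64 * \<psi>\<^sup>2 + 2 * \<epsilon>) + R \<omega>"
      using S_AE min AE_space
    proof eventually_elim
      fix \<omega>
      assume S_le: "\<forall>j\<in>J. \<forall>f\<in>F. \<forall>g\<in>F. L2_norm M (\<lambda>x. f x - g x) \<le> 8 * \<delta> j \<longrightarrow>
          ennreal ((Z f \<omega> - Z g \<omega>) ^ 4) \<le> S j \<omega>"
        and min: "near_minimizer M N A Q W n f F \<epsilon> (fhat \<omega>) \<omega>" and "\<omega> \<in> space P"
      then have g: "fhat \<omega> \<in> F" using fhat by blast
      define X where "X = \<bar>Z (fhat \<omega>) \<omega> - Z f \<omega>\<bar>"
      have D0: "0 \<le> D \<omega>" by (simp add: D_def)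
      have basic: "(D \<omega>)\<^sup>2 \<le> 2 * s * X + \<epsilon>"
        using near_minimizer_norm_le[OF F_dom f g min] by (simp add: D_def s_def X_def)
      have "D \<omega> \<le> B2 + B2"
        unfolding D_def using F_bounded f g
        by (intro order_trans[OF L2_norm_diff_le[OF F_L2[OF g] F_L2[OF f]]] add_mono) auto
      then have D_le: "D \<omega> \<le> 2 * B2" by simp
      show "ennreal ((D \<omega>)\<^sup>2) \<le> ennreal (64 * \<psi>\<^sup>2 + 2 * \<epsilon>) + R \<omega>"
      \<comment> \<open>In the second case \<open>\<epsilon>\<close> is less than half of
        \<open>(D \<omega>)\<^sup>2\<close> and is absorbed by the left side of
        \<open>basic\<close>, which doubles the constant there.\<close>
      proof (cases "D \<omega> \<le> 8 * \<psi> \<or> (D \<omega>)\<^sup>2 \<le> 2 * \<epsilon>")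
        case True
        then have "(D \<omega>)\<^sup>2 \<le> 64 * \<psi>\<^sup>2 + 2 * \<epsilon>"
        proof
          assume "D \<omega> \<le> 8 * \<psi>"
          then have "(D \<omega>)\<^sup>2 \<le> (8 * \<psi>)\<^sup>2" using D0 by (intro power_mono)
          then show ?thesis using \<epsilon> by (simp add: power_mult_distrib)
        next
          assume "(D \<omega>)\<^sup>2 \<le> 2 * \<epsilon>"
          then show ?thesis using zero_le_power2[of \<psi>] by linarith
        qed
        then show ?thesis by (rule order_trans[OF ennreal_leI]) simp
      next
        case False
        \<comment> \<open>As \<open>D \<omega>\<close> exceeds \<open>8 * \<delta> 0\<close>, the
          index \<open>j\<close> is positive, and minimality gives
          \<open>D \<omega> > 8 * \<delta> (j - 1) = 4 * \<delta> j\<close>.\<close>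
        define j where "j = (LEAST j. D \<omega> \<le> 8 * \<delta> j)"
        obtain i where "D \<omega> / (8 * \<psi>) < 2 ^ i"
          using real_arch_pow[of 2 "D \<omega> / (8 * \<psi>)"] by auto
        then have "D \<omega> \<le> 8 * \<delta> i" using \<psi> by (simp add: \<delta>_def field_simps)
        then have j: "D \<omega> \<le> 8 * \<delta> j" unfolding j_def by (rule LeastI)
        have "j \<noteq> 0" using j False by (intro notI) (simp add: \<delta>_def)
        then obtain i where i: "j = Suc i" using not0_implies_Suc by blast
        then have "\<not> D \<omega> \<le> 8 * \<delta> i" using not_less_Least[of i "\<lambda>j. D \<omega> \<le> 8 * \<delta> j"] by (simp add: j_def)
        then have D_gt: "4 * \<delta> j < D \<omega>" by (simp add: i \<delta>_def)
        then have "j \<in> J" using D_le by (simp add: J_def)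
        then have XS: "ennreal (X ^ 4) \<le> S j \<omega>"
          using S_le g f j by (simp add: X_def D_def power_even_abs)
        have "(D \<omega>)\<^sup>2 \<le> 4 * s * X" using basic False by linarith
        then have "((D \<omega>)\<^sup>2) ^ 4 \<le> (4 * s * X) ^ 4" by (intro power_mono) auto
        then have "(D \<omega>) ^ 8 \<le> 256 * s ^ 4 * X ^ 4" by (simp add: power_mult_distrib flip: power_mult)
        then have "(D \<omega>)\<^sup>2 * (D \<omega>) ^ 6 \<le> 256 * s ^ 4 * X ^ 4" by (simp flip: power_add)
        moreover have "(D \<omega>)\<^sup>2 * (4 * \<delta> j) ^ 6 \<le> (D \<omega>)\<^sup>2 * (D \<omega>) ^ 6"
          using D_gt \<delta>[of j] by (intro mult_left_mono power_mono) auto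
        ultimately have "(D \<omega>)\<^sup>2 * (4 * \<delta> j) ^ 6 \<le> 256 * s ^ 4 * X ^ 4"
          by (rule order_trans[rotated])
        then have "(D \<omega>)\<^sup>2 * (16 * \<delta> j ^ 6) \<le> s ^ 4 * X ^ 4"
          by (simp add: power_mult_distrib mult_ac)
        then have "(D \<omega>)\<^sup>2 \<le> s ^ 4 * X ^ 4 / (16 * \<delta> j ^ 6)"
          using \<delta>[of j] by (subst pos_le_divide_eq) auto
        then have "(D \<omega>)\<^sup>2 \<le> q j * X ^ 4" by (simp add: q_def)
        then have "ennreal ((D \<omega>)\<^sup>2) \<le> ennreal (q j) * ennreal (X ^ 4)"
          using q by (simp add: ennreal_mult[symmetric] ennreal_leI)
        also have "\<dots> \<le> ennreal (q j) * (if j \<in> J then S j \<omega> else 0)"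
          using XS \<open>j \<in> J\<close> by (simp add: mult_left_mono)
        also have "\<dots> = (\<Sum>i\<in>{j}. ennreal (q i) * (if i \<in> J then S i \<omega> else 0))" by simp
        also have "\<dots> \<le> R \<omega>" unfolding R_def by (intro sum_le_suminf) auto
        finally show ?thesis by (rule order_trans) simp
      qed
    qed
    then have "(\<integral>\<^sup>+\<omega>. ennreal ((D \<omega>)\<^sup>2) \<partial>P) \<le> (\<integral>\<^sup>+\<omega>. ennreal (64 * \<psi>\<^sup>2 + 2 * \<epsilon>) + R \<omega> \<partial>P)"
      by (rule nn_integral_mono_AE)
    also have "\<dots> = ennreal (64 * \<psi>\<^sup>2 + 2 * \<epsilon>) + (\<integral>\<^sup>+\<omega>. R \<omega> \<partial>P)"
      using S_meas unfolding R_def by (subst nn_integral_add) (auto simp: P.emeasure_space_1)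
    also have "(\<integral>\<^sup>+\<omega>. R \<omega> \<partial>P) \<le> ennreal (K / C ^ 4 * \<psi>\<^sup>2)"
    proof -
      \<comment> \<open>The bound for the shell of index 0. In \<open>j\<close>, the weight
        \<open>q j\<close> decays like \<open>(2 ^ j) ^ 6\<close> in the denominator while
        \<open>G (\<delta> j) ^ 4\<close> gains at most \<open>(2 ^ j) ^ 4\<close>, so a factor
        \<open>(1 / 4) ^ j\<close> remains.\<close>
      define \<kappa> where "\<kappa> = K * \<psi>\<^sup>2 / (16 * C ^ 4)"
      have \<kappa>: "0 \<le> \<kappa>" using K C_pos by (simp add: \<kappa>_def)
      have "(\<integral>\<^sup>+\<omega>. R \<omega> \<partial>P) = (\<Sum>j. ennreal (q j) * (\<integral>\<^sup>+\<omega>. (if j \<in> J then S j \<omega> else 0) \<partial>P))"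
        unfolding R_def using S_meas by (simp add: nn_integral_suminf nn_integral_cmult)
      also have "\<dots> \<le> (\<Sum>j. ennreal (\<kappa> * (1 / 4) ^ j))"
      proof (intro suminf_le)
        fix j
        show "ennreal (q j) * (\<integral>\<^sup>+\<omega>. (if j \<in> J then S j \<omega> else 0) \<partial>P) \<le> ennreal (\<kappa> * (1 / 4) ^ j)"
        proof (cases "j \<in> J")
          case True
          have \<delta>j: "2 ^ j * \<psi> \<le> B2" using True \<delta>[of j] by (simp add: J_def \<delta>_def)
          have "0 \<le> s * G \<psi>" using s G_nonneg[of \<psi>] \<psi> by simp
          moreover have "s * G \<psi> \<le> \<psi>\<^sup>2 / C" using rate C_pos by (simp add: s_def field_simps)
          ultimately have "(s * G \<psi>) ^ 4 \<le> (\<psi>\<^sup>2 / C) ^ 4" by (rule power_mono[rotated])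
          then have sG: "s ^ 4 * G \<psi> ^ 4 \<le> \<psi> ^ 8 / C ^ 4"
            by (simp add: power_mult_distrib power_divide flip: power_mult)
          have "G (\<delta> j) ^ 4 \<le> (2 ^ j * G \<psi>) ^ 4"
            using G_double_power[OF \<psi>(1) \<delta>j] G_nonneg[of "\<delta> j"] \<delta>[of j] \<delta>j
            by (intro power_mono) (auto simp: \<delta>_def)
          then have "q j * (K * G (\<delta> j) ^ 4) \<le> q j * (K * (2 ^ j * G \<psi>) ^ 4)"
            using q K by (intro mult_left_mono) auto
          also have "\<dots> = K * (2 ^ j) ^ 4 / (16 * (2 ^ j) ^ 6 * \<psi> ^ 6) * (s ^ 4 * G \<psi> ^ 4)"
            by (simp add: q_def \<delta>_def power_mult_distrib mult_ac)
          also have "\<dots> \<le> K * (2 ^ j) ^ 4 / (16 * (2 ^ j) ^ 6 * \<psi> ^ 6) * (\<psi> ^ 8 / C ^ 4)"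
            using sG K \<psi> by (intro mult_left_mono) auto
          also have "\<dots> = \<kappa> * (1 / (2 ^ j)\<^sup>2)"
            using \<psi> C_pos by (simp add: \<kappa>_def field_simps eval_nat_numeral)
          also have "1 / (2 ^ j)\<^sup>2 = (1 / 4 :: real) ^ j"
            by (simp add: power_one_over power_mult[symmetric] mult.commute[of j] power_mult)
          finally have le: "q j * (K * G (\<delta> j) ^ 4) \<le> \<kappa> * (1 / 4) ^ j" .
          have "ennreal (q j) * (\<integral>\<^sup>+\<omega>. S j \<omega> \<partial>P) \<le> ennreal (q j) * ennreal (K * G (\<delta> j) ^ 4)"
            using S True by (intro mult_left_mono) auto
          also have "\<dots> = ennreal (q j * (K * G (\<delta> j) ^ 4))" using q by (simp add: ennreal_mult')
          also have "\<dots> \<le> ennreal (\<kappa> * (1 / 4) ^ j)" using le by (rule ennreal_leI)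
          finally show ?thesis using True by simp
        qed simp
      qed auto
      also have "\<dots> = ennreal (\<Sum>j. \<kappa> * (1 / 4) ^ j)"
        using \<kappa> by (intro suminf_ennreal2 summable_mult summable_geometric) auto
      also have "(\<Sum>j. \<kappa> * (1 / 4) ^ j) = \<kappa> * (4 / 3)"
        by (simp add: suminf_mult summable_geometric suminf_geometric)
      also have "ennreal (\<kappa> * (4 / 3)) \<le> ennreal (K / C ^ 4 * \<psi>\<^sup>2)"
        using K C_pos by (intro ennreal_leI) (simp add: \<kappa>_def field_simps)
      finally show ?thesis .
    qed
    also have "ennreal (64 * \<psi>\<^sup>2 + 2 * \<epsilon>) + ennreal (K / C ^ 4 * \<psi>\<^sup>2)
        = ennreal (64 * \<psi>\<^sup>2 + 2 * \<epsilon> + K / C ^ 4 * \<psi>\<^sup>2)"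
      using K C_pos \<epsilon> by (intro ennreal_plus[symmetric]) auto
    also have "\<dots> \<le> ennreal ((66 + K / C ^ 4) * (\<psi>\<^sup>2 + \<epsilon>))"
    proof (intro ennreal_leI)
      have "0 \<le> K / C ^ 4 * \<epsilon>" using K(1) C_pos \<epsilon> by simp
      moreover have "(66 + K / C ^ 4) * (\<psi>\<^sup>2 + \<epsilon>)
          = 66 * \<psi>\<^sup>2 + 66 * \<epsilon> + K / C ^ 4 * \<psi>\<^sup>2 + K / C ^ 4 * \<epsilon>"
        by (simp only: distrib_left distrib_right)
      ultimately show "64 * \<psi>\<^sup>2 + 2 * \<epsilon> + K / C ^ 4 * \<psi>\<^sup>2 \<le> (66 + K / C ^ 4) * (\<psi>\<^sup>2 + \<epsilon>)"
        using \<epsilon> zero_le_power2[of \<psi>] by linarith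
    qed
    finally have "(\<integral>\<^sup>+\<omega>. ennreal ((D \<omega>)\<^sup>2) \<partial>P) \<le> ennreal ((66 + K / C ^ 4) * (\<psi>\<^sup>2 + \<epsilon>))"
      by (simp add: add_left_mono)
    \<comment> \<open>This identity holds for every nonnegative measurable integrand. The
      nonnegative integral has just been bounded by a finite number, so the expectation is its true
      value and not a default.\<close>
    moreover have "prob_space.expectation P (\<lambda>\<omega>. (D \<omega>)\<^sup>2) = enn2real (\<integral>\<^sup>+\<omega>. ennreal ((D \<omega>)\<^sup>2) \<partial>P)"
      using meas unfolding D_def[symmetric] by (intro integral_eq_nn_integral) auto
    ultimately show ?thesis
      using K C_pos \<epsilon> unfolding D_def[symmetric] by (simp add: enn2real_leI)
  qed
  moreover have "0 < 66 + K / C ^ 4" using K C_pos by (simp add: add_pos_pos)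
  ultimately show ?thesis using that by blast
qed

end

text \<open>The constant of \<open>expectation_le\<close> serves at every \<open>n\<close> where the
  three conditions in \<open>\<psi>_rate\<close> hold, hence eventually.\<close>

theorem theorem3:
  fixes \<nu> :: "'y measure"
    and P :: "'w measure"
    and W :: "('y \<Rightarrow> real) \<Rightarrow> 'w \<Rightarrow> real"
    and A :: "(real ^ 'd \<Rightarrow> real) \<Rightarrow> ('y \<Rightarrow> real)"
    and Ainv :: "('y \<Rightarrow> real) \<Rightarrow> (real ^ 'd \<Rightarrow> real)"
    and Q :: "(real ^ 'd \<Rightarrow> real) \<Rightarrow> ('y \<Rightarrow> real)"
    and F :: "(real ^ 'd \<Rightarrow> real) set"
    and Net :: "real \<Rightarrow> (real ^ 'd \<Rightarrow> real) set"
    and G :: "real \<Rightarrow> real"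
    and B2 a c C :: real
    and \<psi> :: "nat \<Rightarrow> real"
  assumes A_linear: "L2_linear lebesgue \<nu> A"
    and A_inverse: "L2_inverse lebesgue \<nu> A Ainv"
    and range_dense: "L2_dense \<nu> (L2_range lebesgue \<nu> A)"
    and Q_adjoint: "L2_adjoint lebesgue \<nu> (L2_range lebesgue \<nu> A) Ainv Q"
    and P_prob: "prob_space P"
    and W_noise: "white_noise P \<nu> W"
    and F_dom: "F \<subseteq> L2_adjoint_dom lebesgue \<nu> (L2_range lebesgue \<nu> A) Ainv"
    and B2_pos: "0 < B2"
    and F_bounded: "\<forall>g\<in>F. L2_norm lebesgue g \<le> B2"
    and separable: "separable_process P lebesgue F (\<lambda>g. W (Q g))"
    and Net_dom: "\<forall>\<delta>>0. Net \<delta> \<subseteq> L2_adjoint_dom lebesgue \<nu> (L2_range lebesgue \<nu> A) Ainv"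
    and Net_finite: "\<forall>\<delta>>0. finite (Net \<delta>)"
    and Net_net: "\<forall>\<delta>>0. L2_net lebesgue F \<delta> (Net \<delta>)"
    and G_def: "G = entropy_integral lebesgue \<nu> Q Net"
    and G_converges:
      "\<forall>\<delta>\<in>{0<..B2}. set_integrable lborel {0<..\<delta>} (entropy_integrand lebesgue \<nu> Q Net)"
    and G_decreasing: "antimono_on {0<..B2} (\<lambda>\<delta>. G \<delta> / \<delta>\<^sup>2)"
    and a_range: "0 \<le> a" "a < 1"
    and c_pos: "c > 0"
    and ratio_eq: "\<forall>\<delta>\<in>{0<..B2}. operator_ratio lebesgue \<nu> Q Net \<delta> = c * \<delta> powr (- a)"
    and G_limit: "filterlim (\<lambda>\<delta>. G \<delta> * \<delta> powr (a - 1)) at_top (at_right 0)"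
    and integrand_decreasing: "antimono_on {0<..B2} (entropy_integrand lebesgue \<nu> Q Net)"
    and C_pos: "C > 0"
    and \<psi>_rate:
      "\<forall>\<^sub>F n in sequentially.
         0 < \<psi> n \<and> \<psi> n \<le> B2 \<and> (\<psi> n)\<^sup>2 \<ge> C * real n powr (-1/2) * G (\<psi> n)"
    and \<psi>_limit: "filterlim (\<lambda>n. real n * \<psi> n powr (2 * (1 + a))) at_top sequentially"
  shows "\<exists>C'>0. \<forall>\<^sub>F n in sequentially. \<forall>f\<in>F. \<forall>\<epsilon>>0. \<forall>fhat :: 'w \<Rightarrow> real ^ 'd \<Rightarrow> real.
           (\<forall>\<omega>\<in>space P. fhat \<omega> \<in> F) \<longrightarrow>
           (\<lambda>\<omega>. L2_norm lebesgue (\<lambda>x. fhat \<omega> x - f x)) \<in> borel_measurable P \<longrightarrow>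
           (AE \<omega> in P. near_minimizer lebesgue \<nu> A Q W n f F \<epsilon> (fhat \<omega>) \<omega>) \<longrightarrow>
           prob_space.expectation P (\<lambda>\<omega>. (L2_norm lebesgue (\<lambda>x. fhat \<omega> x - f x))\<^sup>2)
             \<le> C' * ((\<psi> n)\<^sup>2 + \<epsilon>)"
proof -
  interpret white_noise_problem lebesgue \<nu> A Ainv Q F Net G B2 a c P W
    by (intro white_noise_problem.intro white_noise_problem_axioms.intro entropy_problem.intro
        entropy_problem_axioms.intro inverse_problem.intro) (fact assms)+
  obtain K where K: "0 < K"
    "\<And>n \<psi> f \<epsilon> fhat. 0 < \<psi> \<Longrightarrow> \<psi> \<le> B2 \<Longrightarrow> C * real n powr (-1/2) * G \<psi> \<le> \<psi>\<^sup>2 \<Longrightarrow>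
      f \<in> F \<Longrightarrow> 0 < \<epsilon> \<Longrightarrow> \<forall>\<omega>\<in>space P. fhat \<omega> \<in> F \<Longrightarrow>
      (\<lambda>\<omega>. L2_norm lebesgue (\<lambda>x. fhat \<omega> x - f x)) \<in> borel_measurable P \<Longrightarrow>
      AE \<omega> in P. near_minimizer lebesgue \<nu> A Q W n f F \<epsilon> (fhat \<omega>) \<omega> \<Longrightarrow>
      prob_space.expectation P (\<lambda>\<omega>. (L2_norm lebesgue (\<lambda>x. fhat \<omega> x - f x))\<^sup>2) \<le> K * (\<psi>\<^sup>2 + \<epsilon>)"
    using expectation_le[OF F_bounded C_pos] by blast
  show ?thesis
  proof (intro exI conjI)
    show "\<forall>\<^sub>F n in sequentially. \<forall>f\<in>F. \<forall>\<epsilon>>0. \<forall>fhat :: 'w \<Rightarrow> real ^ 'd \<Rightarrow> real.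
           (\<forall>\<omega>\<in>space P. fhat \<omega> \<in> F) \<longrightarrow>
           (\<lambda>\<omega>. L2_norm lebesgue (\<lambda>x. fhat \<omega> x - f x)) \<in> borel_measurable P \<longrightarrow>
           (AE \<omega> in P. near_minimizer lebesgue \<nu> A Q W n f F \<epsilon> (fhat \<omega>) \<omega>) \<longrightarrow>
           prob_space.expectation P (\<lambda>\<omega>. (L2_norm lebesgue (\<lambda>x. fhat \<omega> x - f x))\<^sup>2)
             \<le> K * ((\<psi> n)\<^sup>2 + \<epsilon>)"
      using \<psi>_rate by eventually_elim (intro ballI allI impI K(2), auto)
  qed (fact K(1))
qed

end
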